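(* Let $(\mathcal{L}^*,\mathcal{I}^*,X,\bar{Y})$ be a quadruple satisfying the $n$-variable theorem (in the sense defined in the context), and let $D=D^{\mathcal{L}^*,\mathcal{I}^*}_{X,\bar{Y}}\in\mathfrak{D}_{n\text{-var}}$. Let $\mathcal{L}$ be a language, $T$ a complete $\mathcal{L}$-theory, and $\mathbb{M}\models T$ a sufficiently saturated model. If $T\notin D$, then there exist an $\mathcal{L}$-formula $\varphi(\bar{x},y)$ and an $\mathcal{I}^*$-indexed $\mathcal{I}^*_{\mathcal{L}^*}$-indiscernible set $(a_\eta)_{\eta\in\mathcal{I}^*}$ in $\mathbb{M}$ such that (i) $\varphi(\bar{x},y)$ witnesses $T\notin D$ with $(a_\eta)_{\eta\in\mathcal{I}^*}$, i.e. $\{\varphi(\bar{x},a_\eta)\}_{\eta\in X}$ is consistent and $\{\varphi(\bar{x},a_\eta)\}_{\eta\in Y}$ is inconsistent for each $Y\in\bar{Y}$; (ii) there exists $\bar{b}\models\{\varphi(\bar{x},a_\eta)\}_{\eta\in X}$ such that $\dim(\bar{b}/(a_\eta)_{\eta\in\mathcal{I}^*})=|\bar{x}|$.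
   Context: Notation. $|x|$ is the length of a tuple $x$. Let $\mathcal{L}^*$ be a language and $\mathcal{I}^*$ an $\mathcal{L}^*$-structure. For tuples $\bar\eta,\bar\nu$ from $\mathcal{I}^*$ of the same length, $\bar\eta\sim\bar\nu$ means they have the same quantifier-free $\mathcal{L}^*$-type in $\mathcal{I}^*$. For $I,J\subseteq\mathcal{I}^*$, $I\sim J$ means $I,J$ have enumerations with the same quantifier-free type; $I\sim^{\mathrm{fin}}J$ means every finite $I_0\subseteq I$ satisfies $I_0\sim J_0$ for some $J_0\subseteq J$, and every finite $J_0\subseteq J$ satisfies $J_0\sim I_0$ for some $I_0\subseteq I$. $\langle\eta\rangle$ is the substructure of $\mathcal{I}^*$ generated by $\eta$, and $\langle\eta\rangle\sim\langle\nu\rangle$ means there is an isomorphism $\langle\eta\rangle\to\langle\nu\rangle$ sending $\eta$ to $\nu$. $\mathrm{age}(\mathcal{I}^* )$ is the class of $\mathcal{L}^*$-structures isomorphic to a finitely generated substructure of $\mathcal{I}^*$. $\mathcal{I}^*$ is locally finite if all its finitely generated substructures are finite. Generalized indiscernibles. Let $\mathbb{M}$ be a sufficiently saturated $\mathcal{L}$-structure, $A\subseteq\mathbb{M}$ small, and $(a_\eta)_{\eta\in\mathcal{I}^*}$ tuples of $\mathbb{M}$ of the same length. $(a_\eta)$ is $\mathcal{I}^*_{\mathcal{L}^*}$-indiscernible over $A$ if $\bar\eta\sim\bar\nu$ implies $\mathrm{tp}_{\mathcal{L}}((a_{\eta_i})_i/A)=\mathrm{tp}_{\mathcal{L}}((a_{\nu_i})_i/A)$.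 $\mathcal{I}^*$ has the modeling property if for every language $\mathcal{L}$, every $\mathcal{L}$-theory with monster model $\mathbb{M}$, small $A\subseteq\mathbb{M}$, and $(a_\eta)_{\eta\in\mathcal{I}^*}$ in $\mathbb{M}$ of the same length, there is $(b_\eta)_{\eta\in\mathcal{I}^*}$ in $\mathbb{M}$ which is $\mathcal{I}^*_{\mathcal{L}^*}$-indiscernible over $A$ and such that for every finite tuple $\bar\eta$ of $\mathcal{I}^*$ and $\varphi\in\mathrm{tp}((b_{\eta_i})_i/A)$ there is $\bar\nu\sim\bar\eta$ with $\mathbb{M}\models\varphi((a_{\nu_i})_i)$. Conditions on index structures. $\mathcal{I}^*$ is weakly monochromatic if the substructures $\langle\eta\rangle$ ($\eta\in\mathcal{I}^*$ a single element) fall into finitely many isomorphism types. For $J\subseteq\mathcal{I}^*$, $\mathcal{I}^*$ is monochromatically extendable over $J$ if for every cardinal $\lambda$ there is an $\mathcal{L}^*$-structure $\mathcal{I}^\dagger$ with $\mathrm{age}(\mathcal{I}^\dagger)=\mathrm{age}(\mathcal{I}^* )$ such that for every $c:\mathcal{I}^\dagger\to\lambda$ there is an $\mathcal{L}^*$-embedding $f:\mathcal{I}^*\to\mathcal{I}^\dagger$ with $c(f(\eta))=c(f(\nu))$ whenever $\eta,\nu\in J$ and $\langle\eta\rangle\sim\langle\nu\rangle$. $X\subseteq\mathcal{I}^*$ is cofinal in $\mathcal{I}^*$ if for every finite $Z\subseteq\mathcal{I}^*$ there is an $\mathcal{L}^*$-embedding $f:\mathcal{I}^*\to\mathcal{I}^*$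 such that $f(\mathcal{I}^* )\cap Z=\emptyset$; for all finite tuples $\bar\eta,\bar\nu$ of the same length in $f(\mathcal{I}^* )$, $\bar\eta\sim\bar\nu$ implies $\bar\eta Z\sim\bar\nu Z$ (with $Z$ enumerated in a fixed way); and $f(\mathcal{I}^* )\cap X\sim^{\mathrm{fin}}X$. The quadruple $(\mathcal{L}^*,\mathcal{I}^*,X,\bar{Y})$ "satisfies the $n$-variable theorem" if: (i) $\mathcal{I}^*$ is a locally finite $\mathcal{L}^*$-structure with the modeling property, $X\subseteq\mathcal{I}^*$, and $\bar{Y}$ is a finite set of subsets of $\mathcal{I}^*$; (ii) $\mathcal{I}^*$ is weakly monochromatic; (iii) $X$ is cofinal in $\mathcal{I}^*$; (iv) $\mathcal{I}^*$ is monochromatically extendable over $\mathbb{X}:=\{\eta\in\mathcal{I}^*:\langle\eta\rangle\sim\langle\nu\rangle\text{ for some }\nu\in X\}$; (v) $Y\subseteq\mathbb{X}$ for each $Y\in\bar{Y}$; (vi) $|Y|>1$ for each $Y\in\bar{Y}$; (vii) there is a disjoint union $W\subseteq\mathcal{I}^*$ of sets $X',Y'$ such that $X'\sim^{\mathrm{fin}}X$, $Y'\sim^{\mathrm{fin}}Y$ for some $Y\in\bar{Y}$, and $\{\eta\}\cup X'\sim^{\mathrm{fin}}X$ for each $\eta\in Y'$. For such a quadruple, $D^{\mathcal{L}^*,\mathcal{I}^*}_{X,\bar{Y}}$ is the class of complete first-order theories $T$ for which there do not exist a formula $\varphi(x,y)$ in the language of $T$ and an $\mathcal{I}^*_{\mathcal{L}^*}$-indiscernible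 $(a_\eta)_{\eta\in\mathcal{I}^*}$ in a model of $T$ such that $\{\varphi(x,a_\eta)\}_{\eta\in X}$ is consistent and $\{\varphi(x,a_\eta)\}_{\eta\in Y}$ is inconsistent for each $Y\in\bar{Y}$. $\mathfrak{D}_{n\text{-var}}$ is the class of all such $D^{\mathcal{L}^*,\mathcal{I}^*}_{X,\bar{Y}}$. (The "$n$" is only part of the name.) Algebraic dimension. A set $B$ of elements of $\mathbb{M}$ is algebraically independent over $A$ if $b\notin\mathrm{acl}(A\cup(B\setminus\{b\}))$ for all $b\in B$. For $\bar{b}=(b_0,\dots,b_{m-1})\in\mathbb{M}^m$, $\dim(\bar{b}/A)$ is the maximum of $|B|$ over subsets $B\subseteq\{b_0,\dots,b_{m-1}\}$ algebraically independent over $A$. *)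

theory Defs
  imports Main
begin

unbundle cardinal_syntax

section \<open>First-order languages, structures and formulas\<close>

record ('f, 'r) lang =
  funs :: "'f set"
  rels :: "'r set"
  far :: "'f \<Rightarrow> nat"
  rar :: "'r \<Rightarrow> nat"

record ('f, 'r, 'a) struct =
  carr :: "'a set"
  fn :: "'f \<Rightarrow> 'a list \<Rightarrow> 'a"
  rel :: "'r \<Rightarrow> 'a list \<Rightarrow> bool"

datatype 'f trm = Var nat | App 'f "'f trm list"

datatype ('f, 'r) fm =
    Eq "'f trm" "'f trm"
  | Rel 'r "'f trm list"
  | Neg "('f, 'r) fm"
  | Conj "('f, 'r) fm" "('f, 'r) fm"
  | Ex nat "('f, 'r) fm"

fun wf_trm :: "('f, 'r) lang \<Rightarrow> 'f trm \<Rightarrow> bool" where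
  "wf_trm L (Var i) = True"
| "wf_trm L (App f ts) = (f \<in> funs L \<and> length ts = far L f \<and> (\<forall>t\<in>set ts. wf_trm L t))"

fun tvars :: "'f trm \<Rightarrow> nat set" where
  "tvars (Var i) = {i}"
| "tvars (App f ts) = (\<Union>t\<in>set ts. tvars t)"

fun wf_fm :: "('f, 'r) lang \<Rightarrow> ('f, 'r) fm \<Rightarrow> bool" where
  "wf_fm L (Eq s t) = (wf_trm L s \<and> wf_trm L t)"
| "wf_fm L (Rel r ts) = (r \<in> rels L \<and> length ts = rar L r \<and> (\<forall>t\<in>set ts. wf_trm L t))"
| "wf_fm L (Neg p) = wf_fm L p"
| "wf_fm L (Conj p q) = (wf_fm L p \<and> wf_fm L q)"
| "wf_fm L (Ex i p) = wf_fm L p"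

fun fvars :: "('f, 'r) fm \<Rightarrow> nat set" where
  "fvars (Eq s t) = tvars s \<union> tvars t"
| "fvars (Rel r ts) = (\<Union>t\<in>set ts. tvars t)"
| "fvars (Neg p) = fvars p"
| "fvars (Conj p q) = fvars p \<union> fvars q"
| "fvars (Ex i p) = fvars p - {i}"

fun qfree :: "('f, 'r) fm \<Rightarrow> bool" where
  "qfree (Eq s t) = True"
| "qfree (Rel r ts) = True"
| "qfree (Neg p) = qfree p"
| "qfree (Conj p q) = (qfree p \<and> qfree q)"
| "qfree (Ex i p) = False"

definition tuples :: "('f, 'r, 'a) struct \<Rightarrow> nat \<Rightarrow> 'a list set" where
  "tuples M n = {xs. length xs = n \<and> set xs \<subseteq> carr M}"

definition is_struct :: "('f, 'r) lang \<Rightarrow> ('f, 'r, 'a) struct \<Rightarrow> bool" where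
  "is_struct L M \<longleftrightarrow> carr M \<noteq> {} \<and> (\<forall>f\<in>funs L. \<forall>xs\<in>tuples M (far L f). fn M f xs \<in> carr M)"

fun val :: "('f, 'r, 'a) struct \<Rightarrow> (nat \<Rightarrow> 'a) \<Rightarrow> 'f trm \<Rightarrow> 'a" where
  "val M v (Var i) = v i"
| "val M v (App f ts) = fn M f (map (val M v) ts)"

fun sat :: "('f, 'r, 'a) struct \<Rightarrow> (nat \<Rightarrow> 'a) \<Rightarrow> ('f, 'r) fm \<Rightarrow> bool" where
  "sat M v (Eq s t) = (val M v s = val M v t)"
| "sat M v (Rel r ts) = rel M r (map (val M v) ts)"
| "sat M v (Neg p) = (\<not> sat M v p)"
| "sat M v (Conj p q) = (sat M v p \<and> sat M v q)"
| "sat M v (Ex i p) = (\<exists>a\<in>carr M. sat M (v(i := a)) p)"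

definition fmls :: "('f, 'r) lang \<Rightarrow> nat \<Rightarrow> ('f, 'r) fm set" where
  "fmls L n = {\<phi>. wf_fm L \<phi> \<and> fvars \<phi> \<subseteq> {..<n}}"

text \<open>
  A tuple is a list, and the \<open>i\<close>-th entry is substituted for the \<open>i\<close>-th variable. This is only
  used for formulas in \<^term>\<open>fmls L (length xs)\<close>, so the value of \<^term>\<open>xs ! i\<close> outside
  the list is irrelevant. A formula \<open>\<phi>(x, y)\<close> with \<open>|x| = n\<close> and \<open>|y| = m\<close> is an element
  of \<^term>\<open>fmls L (n + m)\<close>, and \<open>M \<Turnstile> \<phi>(b, a)\<close> is \<open>holds M \<phi> (b @ a)\<close>.
\<close>

definition holds :: "('f, 'r, 'a) struct \<Rightarrow> ('f, 'r) fm \<Rightarrow> 'a list \<Rightarrow> bool" where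
  "holds M \<phi> xs \<longleftrightarrow> sat M (\<lambda>i. xs ! i) \<phi>"

section \<open>Theories\<close>

definition models :: "('f, 'r) lang \<Rightarrow> ('f, 'r, 'a) struct \<Rightarrow> ('f, 'r) fm set \<Rightarrow> bool" where
  "models L M T \<longleftrightarrow> is_struct L M \<and> (\<forall>\<sigma>\<in>T. holds M \<sigma> [])"

text \<open>
  HOL cannot quantify over models of all types. By downward Loewenheim-Skolem, a set of
  \<open>L\<close>-sentences with a model has a model of cardinality at most \<open>|L| + \<aleph>\<^sub>0\<close>, hence one
  whose carrier consists of elements of the type of formulas. So nothing is lost by using only
  models of that type in the definitions of satisfiability and consequence.
\<close>

definition satisfiable :: "('f, 'r) lang \<Rightarrow> ('f, 'r) fm set \<Rightarrow> bool" where
  "satisfiable L T \<longleftrightarrow> (\<exists>N :: ('f, 'r, ('f, 'r) fm) struct. models L N T)"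

definition entails :: "('f, 'r) lang \<Rightarrow> ('f, 'r) fm set \<Rightarrow> ('f, 'r) fm \<Rightarrow> bool" where
  "entails L T \<sigma> \<longleftrightarrow> (\<forall>N :: ('f, 'r, ('f, 'r) fm) struct. models L N T \<longrightarrow> holds N \<sigma> [])"

definition complete_theory :: "('f, 'r) lang \<Rightarrow> ('f, 'r) fm set \<Rightarrow> bool" where
  "complete_theory L T \<longleftrightarrow> T \<subseteq> fmls L 0 \<and> satisfiable L T \<and>
     (\<forall>\<sigma>\<in>fmls L 0. entails L T \<sigma> \<or> entails L T (Neg \<sigma>))"

section \<open>Types, saturation, algebraic dimension\<close>

text \<open>
  A formula with parameters is a pair \<open>(\<phi>, ps)\<close>; the parameters \<open>ps\<close> are substituted for
  the variables following the \<open>n\<close> free ones.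
\<close>

definition pfmls :: "('f, 'r) lang \<Rightarrow> 'a set \<Rightarrow> nat \<Rightarrow> (('f, 'r) fm \<times> 'a list) set" where
  "pfmls L A n = {(\<phi>, ps). set ps \<subseteq> A \<and> \<phi> \<in> fmls L (n + length ps)}"

definition tp :: "('f, 'r) lang \<Rightarrow> ('f, 'r, 'a) struct \<Rightarrow> 'a set \<Rightarrow> 'a list
    \<Rightarrow> (('f, 'r) fm \<times> 'a list) set" where
  "tp L M A xs = {(\<phi>, ps) \<in> pfmls L A (length xs). holds M \<phi> (xs @ ps)}"

definition realizes :: "('f, 'r, 'a) struct \<Rightarrow> 'a list \<Rightarrow> (('f, 'r) fm \<times> 'a list) set \<Rightarrow> bool" where
  "realizes M bs p \<longleftrightarrow> (\<forall>(\<phi>, ps)\<in>p. holds M \<phi> (bs @ ps))"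

text \<open>
  Consistency of a set of formulas with parameters in \<open>M\<close> is consistency with the elementary
  diagram of \<open>M\<close>, that is, finite satisfiability in \<open>M\<close>.
\<close>

definition consistent :: "('f, 'r, 'a) struct \<Rightarrow> nat \<Rightarrow> (('f, 'r) fm \<times> 'a list) set \<Rightarrow> bool" where
  "consistent M n p \<longleftrightarrow> (\<forall>q\<subseteq>p. finite q \<longrightarrow> (\<exists>bs\<in>tuples M n. realizes M bs q))"

definition saturated :: "('f, 'r) lang \<Rightarrow> ('f, 'r, 'a) struct \<Rightarrow> 'k rel \<Rightarrow> bool" where
  "saturated L M \<kappa> \<longleftrightarrow> (\<forall>A n p. A \<subseteq> carr M \<and> |A| <o \<kappa> \<and> p \<subseteq> pfmls L A n \<and> consistent M n p \<longrightarrow>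
     (\<exists>bs\<in>tuples M n. realizes M bs p))"

text \<open>
  The cardinal \<open>\<kappa>\<close> witnesses that \<open>M\<close> is sufficiently saturated for a language \<open>L\<close> and an
  index set \<open>I\<close>; the small sets are those of cardinality less than \<open>\<kappa>\<close>. The type of \<open>\<kappa>\<close> is
  separate from that of \<open>M\<close>, since a finite \<open>M\<close> is saturated in every infinite cardinal.
\<close>

definition suff_saturated ::
  "('f, 'r) lang \<Rightarrow> ('f, 'r, 'a) struct \<Rightarrow> 'i set \<Rightarrow> 'k rel \<Rightarrow> bool" where
  "suff_saturated L M I \<kappa> \<longleftrightarrow> is_struct L M \<and> Card_order \<kappa> \<and> natLeq <o \<kappa> \<and>
     |funs L| <o \<kappa> \<and> |rels L| <o \<kappa> \<and> |I| <o \<kappa> \<and> saturated L M \<kappa>"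

definition acl :: "('f, 'r) lang \<Rightarrow> ('f, 'r, 'a) struct \<Rightarrow> 'a set \<Rightarrow> 'a set" where
  "acl L M A = {b \<in> carr M. \<exists>(\<phi>, ps)\<in>pfmls L A 1.
     holds M \<phi> (b # ps) \<and> finite {c \<in> carr M. holds M \<phi> (c # ps)}}"

definition alg_indep :: "('f, 'r) lang \<Rightarrow> ('f, 'r, 'a) struct \<Rightarrow> 'a set \<Rightarrow> 'a set \<Rightarrow> bool" where
  "alg_indep L M A B \<longleftrightarrow> (\<forall>b\<in>B. b \<notin> acl L M (A \<union> (B - {b})))"

definition acl_dim :: "('f, 'r) lang \<Rightarrow> ('f, 'r, 'a) struct \<Rightarrow> 'a list \<Rightarrow> 'a set \<Rightarrow> nat" where
  "acl_dim L M bs A = Max {card B | B. B \<subseteq> set bs \<and> alg_indep L M A B}"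

section \<open>Index structures\<close>

definition qf_sim :: "('f, 'r) lang \<Rightarrow> ('f, 'r, 'i) struct \<Rightarrow> 'i list \<Rightarrow> 'i list \<Rightarrow> bool" where
  "qf_sim L I xs ys \<longleftrightarrow> set xs \<subseteq> carr I \<and> set ys \<subseteq> carr I \<and> length xs = length ys \<and>
     (\<forall>\<phi>\<in>fmls L (length xs). qfree \<phi> \<longrightarrow> holds I \<phi> xs = holds I \<phi> ys)"

text \<open>The relation \<open>\<sim>\<close> on subsets is only needed for finite ones, which are enumerated by lists.\<close>

definition set_sim :: "('f, 'r) lang \<Rightarrow> ('f, 'r, 'i) struct \<Rightarrow> 'i set \<Rightarrow> 'i set \<Rightarrow> bool" where
  "set_sim L I A B \<longleftrightarrow> (\<exists>xs ys. distinct xs \<and> set xs = A \<and> distinct ys \<and> set ys = B \<and> qf_sim L I xs ys)"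

definition fin_sim :: "('f, 'r) lang \<Rightarrow> ('f, 'r, 'i) struct \<Rightarrow> 'i set \<Rightarrow> 'i set \<Rightarrow> bool" where
  "fin_sim L I A B \<longleftrightarrow>
     (\<forall>A\<^sub>0\<subseteq>A. finite A\<^sub>0 \<longrightarrow> (\<exists>B\<^sub>0\<subseteq>B. set_sim L I A\<^sub>0 B\<^sub>0)) \<and>
     (\<forall>B\<^sub>0\<subseteq>B. finite B\<^sub>0 \<longrightarrow> (\<exists>A\<^sub>0\<subseteq>A. set_sim L I B\<^sub>0 A\<^sub>0))"

inductive_set gen :: "('f, 'r) lang \<Rightarrow> ('f, 'r, 'i) struct \<Rightarrow> 'i set \<Rightarrow> 'i set"
  for L :: "('f, 'r) lang" and I :: "('f, 'r, 'i) struct" and B :: "'i set" where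
  base: "b \<in> B \<Longrightarrow> b \<in> gen L I B"
| step: "f \<in> funs L \<Longrightarrow> length xs = far L f \<Longrightarrow> \<forall>x\<in>set xs. x \<in> gen L I B \<Longrightarrow> fn I f xs \<in> gen L I B"

definition gen_sub :: "('f, 'r) lang \<Rightarrow> ('f, 'r, 'i) struct \<Rightarrow> 'i set \<Rightarrow> ('f, 'r, 'i) struct" where
  "gen_sub L I B = I\<lparr>carr := gen L I B\<rparr>"

definition embedding ::
  "('f, 'r) lang \<Rightarrow> ('f, 'r, 'a) struct \<Rightarrow> ('f, 'r, 'b) struct \<Rightarrow> ('a \<Rightarrow> 'b) \<Rightarrow> bool" where
  "embedding L M N h \<longleftrightarrow> h ` carr M \<subseteq> carr N \<and> inj_on h (carr M) \<and>
     (\<forall>f\<in>funs L. \<forall>xs\<in>tuples M (far L f). h (fn M f xs) = fn N f (map h xs)) \<and>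
     (\<forall>r\<in>rels L. \<forall>xs\<in>tuples M (rar L r). rel M r xs = rel N r (map h xs))"

definition isomorphism ::
  "('f, 'r) lang \<Rightarrow> ('f, 'r, 'a) struct \<Rightarrow> ('f, 'r, 'b) struct \<Rightarrow> ('a \<Rightarrow> 'b) \<Rightarrow> bool" where
  "isomorphism L M N h \<longleftrightarrow> embedding L M N h \<and> h ` carr M = carr N"

definition isomorphic ::
  "('f, 'r) lang \<Rightarrow> ('f, 'r, 'a) struct \<Rightarrow> ('f, 'r, 'b) struct \<Rightarrow> bool" where
  "isomorphic L M N \<longleftrightarrow> (\<exists>h. isomorphism L M N h)"

definition gen_sim :: "('f, 'r) lang \<Rightarrow> ('f, 'r, 'i) struct \<Rightarrow> 'i \<Rightarrow> 'i \<Rightarrow> bool" where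
  "gen_sim L I \<eta> \<nu> \<longleftrightarrow> (\<exists>h. isomorphism L (gen_sub L I {\<eta>}) (gen_sub L I {\<nu>}) h \<and> h \<eta> = \<nu>)"

definition in_age :: "('f, 'r) lang \<Rightarrow> ('f, 'r, 'a) struct \<Rightarrow> ('f, 'r, 'i) struct \<Rightarrow> bool" where
  "in_age L S I \<longleftrightarrow> (\<exists>B\<subseteq>carr I. finite B \<and> isomorphic L S (gen_sub L I B))"

text \<open>
  The ages are isomorphism-closed classes, so their equality amounts to each containing the
  finitely generated substructures of the other structure.
\<close>

definition same_age :: "('f, 'r) lang \<Rightarrow> ('f, 'r, 'i) struct \<Rightarrow> ('f, 'r, 'j) struct \<Rightarrow> bool" where
  "same_age L I J \<longleftrightarrow>
     (\<forall>B\<subseteq>carr I. finite B \<longrightarrow> in_age L (gen_sub L I B) J) \<and>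
     (\<forall>C\<subseteq>carr J. finite C \<longrightarrow> in_age L (gen_sub L J C) I)"

definition locally_finite :: "('f, 'r) lang \<Rightarrow> ('f, 'r, 'i) struct \<Rightarrow> bool" where
  "locally_finite L I \<longleftrightarrow> (\<forall>B\<subseteq>carr I. finite B \<longrightarrow> finite (gen L I B))"

section \<open>Generalized indiscernibles and the modeling property\<close>

text \<open>
  The index language is \<open>Ls\<close> and \<open>m\<close> is the common length of the tuples \<open>a \<eta>\<close>. Types of
  finite index tuples are compared through the concatenation of the corresponding \<open>a \<eta>\<close>.
\<close>

definition indisc :: "('g, 's) lang \<Rightarrow> ('g, 's, 'i) struct \<Rightarrow> ('f, 'r) lang \<Rightarrow> ('f, 'r, 'a) struct
    \<Rightarrow> 'a set \<Rightarrow> nat \<Rightarrow> ('i \<Rightarrow> 'a list) \<Rightarrow> bool" where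
  "indisc Ls I L M A m a \<longleftrightarrow> (\<forall>\<eta>\<in>carr I. a \<eta> \<in> tuples M m) \<and>
     (\<forall>\<eta>s \<nu>s. qf_sim Ls I \<eta>s \<nu>s \<longrightarrow> tp L M A (concat (map a \<eta>s)) = tp L M A (concat (map a \<nu>s)))"

text \<open>
  HOL cannot quantify over types within a formula, so the classes over which the modeling property
  quantifies are bounded by type arguments: function symbols, relation symbols, elements of the
  monster model, and the type carrying its saturation cardinal. Theorems assuming it are
  polymorphic in these types.
\<close>

definition modeling_property :: "'f itself \<Rightarrow> 'r itself \<Rightarrow> 'm itself \<Rightarrow> 'k itself
    \<Rightarrow> ('g, 's) lang \<Rightarrow> ('g, 's, 'i) struct \<Rightarrow> bool" where
  "modeling_property _ _ _ _ Ls I \<longleftrightarrow>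
     (\<forall>(L :: ('f, 'r) lang) (M :: ('f, 'r, 'm) struct) (\<kappa> :: 'k rel) A m a.
        suff_saturated L M (carr I) \<kappa> \<and> A \<subseteq> carr M \<and> |A| <o \<kappa> \<and> (\<forall>\<eta>\<in>carr I. a \<eta> \<in> tuples M m) \<longrightarrow>
        (\<exists>b. indisc Ls I L M A m b \<and>
             (\<forall>\<eta>s. set \<eta>s \<subseteq> carr I \<longrightarrow> (\<forall>(\<phi>, ps)\<in>tp L M A (concat (map b \<eta>s)).
                \<exists>\<nu>s. qf_sim Ls I \<nu>s \<eta>s \<and> holds M \<phi> (concat (map a \<nu>s) @ ps)))))"

section \<open>The n-variable theorem\<close>

definition weakly_monochromatic :: "('g, 's) lang \<Rightarrow> ('g, 's, 'i) struct \<Rightarrow> bool" where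
  "weakly_monochromatic L I \<longleftrightarrow>
     finite ((\<lambda>\<eta>. {\<nu> \<in> carr I. isomorphic L (gen_sub L I {\<eta>}) (gen_sub L I {\<nu>})}) ` carr I)"

text \<open>
  Here a cardinal is a set \<open>\<Lambda>\<close> of colours of type \<open>'c\<close>, and the extension \<open>I\<^sup>\<dagger>\<close> has elements of
  type \<open>'d\<close>. The type arguments again stand for quantification over types; \<open>'d\<close> is separate
  from \<open>'c\<close> because no bound for the size of \<open>I\<^sup>\<dagger>\<close> in terms of the number of colours is given.
\<close>

definition mono_extendable :: "'c itself \<Rightarrow> 'd itself
    \<Rightarrow> ('g, 's) lang \<Rightarrow> ('g, 's, 'i) struct \<Rightarrow> 'i set \<Rightarrow> bool" where
  "mono_extendable _ _ L I J \<longleftrightarrow> (\<forall>\<Lambda> :: 'c set. \<exists>Id :: ('g, 's, 'd) struct.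
     is_struct L Id \<and> same_age L Id I \<and>
     (\<forall>c. c ` carr Id \<subseteq> \<Lambda> \<longrightarrow> (\<exists>f. embedding L I Id f \<and>
        (\<forall>\<eta>\<in>J. \<forall>\<nu>\<in>J. gen_sim L I \<eta> \<nu> \<longrightarrow> c (f \<eta>) = c (f \<nu>)))))"

definition cofinal_in :: "('g, 's) lang \<Rightarrow> ('g, 's, 'i) struct \<Rightarrow> 'i set \<Rightarrow> bool" where
  "cofinal_in L I X \<longleftrightarrow> (\<forall>Z\<subseteq>carr I. finite Z \<longrightarrow> (\<exists>f. embedding L I I f \<and>
     f ` carr I \<inter> Z = {} \<and>
     (\<forall>zs. distinct zs \<and> set zs = Z \<longrightarrow> (\<forall>\<eta>s \<nu>s. set \<eta>s \<subseteq> f ` carr I \<and> set \<nu>s \<subseteq> f ` carr I \<and>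
        qf_sim L I \<eta>s \<nu>s \<longrightarrow> qf_sim L I (\<eta>s @ zs) (\<nu>s @ zs))) \<and>
     fin_sim L I (f ` carr I \<inter> X) X))"

definition gen_sim_hull :: "('g, 's) lang \<Rightarrow> ('g, 's, 'i) struct \<Rightarrow> 'i set \<Rightarrow> 'i set" where
  "gen_sim_hull L I X = {\<eta> \<in> carr I. \<exists>\<nu>\<in>X. gen_sim L I \<eta> \<nu>}"

definition n_variable_quadruple ::
  "'f itself \<Rightarrow> 'r itself \<Rightarrow> 'm itself \<Rightarrow> 'k itself \<Rightarrow> 'c itself \<Rightarrow> 'd itself
    \<Rightarrow> ('g, 's) lang \<Rightarrow> ('g, 's, 'i) struct \<Rightarrow> 'i set \<Rightarrow> 'i set set \<Rightarrow> bool" where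
  "n_variable_quadruple tf tr tm tk tc td Ls I X Ys \<longleftrightarrow>
     is_struct Ls I \<and> locally_finite Ls I \<and> modeling_property tf tr tm tk Ls I \<and>
     X \<subseteq> carr I \<and> finite Ys \<and> (\<forall>Y\<in>Ys. Y \<subseteq> carr I) \<and>
     weakly_monochromatic Ls I \<and>
     cofinal_in Ls I X \<and>
     mono_extendable tc td Ls I (gen_sim_hull Ls I X) \<and>
     (\<forall>Y\<in>Ys. Y \<subseteq> gen_sim_hull Ls I X) \<and>
     (\<forall>Y\<in>Ys. \<exists>\<eta>\<in>Y. \<exists>\<nu>\<in>Y. \<eta> \<noteq> \<nu>) \<and>
     (\<exists>X' Y'. X' \<subseteq> carr I \<and> Y' \<subseteq> carr I \<and> X' \<inter> Y' = {} \<and>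
        fin_sim Ls I X' X \<and> (\<exists>Y\<in>Ys. fin_sim Ls I Y' Y) \<and>
        (\<forall>\<eta>\<in>Y'. fin_sim Ls I ({\<eta>} \<union> X') X))"

text \<open>The formula \<open>\<phi>(x, y)\<close>, with \<open>|x| = n\<close> and \<open>|y| = m\<close>, together with \<open>(a \<eta>)\<close>.\<close>

definition nvar_witness :: "('f, 'r) lang \<Rightarrow> ('f, 'r, 'a) struct
    \<Rightarrow> 'i set \<Rightarrow> 'i set set \<Rightarrow> ('f, 'r) fm \<Rightarrow> nat \<Rightarrow> nat \<Rightarrow> ('i \<Rightarrow> 'a list) \<Rightarrow> bool" where
  "nvar_witness L M X Ys \<phi> n m a \<longleftrightarrow> \<phi> \<in> fmls L (n + m) \<and>
     consistent M n ((\<lambda>\<eta>. (\<phi>, a \<eta>)) ` X) \<and>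
     (\<forall>Y\<in>Ys. \<not> consistent M n ((\<lambda>\<eta>. (\<phi>, a \<eta>)) ` Y))"

text \<open>
  The class of theories \<open>D\<close>, whose members are theories together with their languages. The type
  argument is that of the elements of the models in which the indiscernibles are sought.
\<close>

definition D_class :: "'n itself \<Rightarrow> ('g, 's) lang \<Rightarrow> ('g, 's, 'i) struct \<Rightarrow> 'i set \<Rightarrow> 'i set set
    \<Rightarrow> (('f, 'r) lang \<times> ('f, 'r) fm set) set" where
  "D_class _ Ls I X Ys = {(L, T). complete_theory L T \<and>
     \<not> (\<exists>(N :: ('f, 'r, 'n) struct) \<phi> n m a. models L N T \<and> indisc Ls I L N {} m a \<and>
          nvar_witness L N X Ys \<phi> n m a)}"

end

theory Submission
  imports Defs "HOL-Library.Nat_Bijection"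
begin

text \<open>
  A \<^emph>\<open>witness\<close> is a formula \<open>\<phi>(x, y)\<close> with an indiscernible family \<open>a\<close> in \<open>M\<close> such that \<open>\<phi>\<close> is
  consistent along \<open>X\<close> and inconsistent along every \<open>Y\<close>. One exists in some model \<open>N\<close> of \<open>T\<close>;
  completeness gives \<open>N \<equiv> M\<close>, and saturation copies the family into \<open>M\<close>
  (\<open>complete_theory_elem_equiv\<close>, \<open>witness_transfer\<close>). Among the witnesses in \<open>M\<close> take one with
  \<open>n = |x|\<close> minimal. Then every realization \<open>b\<close> of \<open>{\<phi>(x, a\<^sub>\<eta>) : \<eta> \<in> X}\<close> consists of \<open>n\<close>
  elements that are algebraically independent over the family.

  Cofinality supplies new witnesses (\<open>relocate_witness\<close>): finitely many parameters \<open>c\<close> of the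
  family can be adjoined to every tuple, provided that the family is first moved along an
  embedding \<open>f\<close> whose image is indiscernible over \<open>c\<close>. If \<open>\<theta>(x', y, c)\<close> has a realization along
  \<open>X\<close> and implies \<open>\<phi>\<close> up to changing the realization uniformly in \<open>y\<close>, then \<open>\<theta>\<close> with the family
  \<open>a\<^bsub>f(\<eta>)\<^esub> c\<close> is again a witness.

  Suppose that \<open>b\<^sub>i\<close> is algebraic over the family and the other coordinates of \<open>b\<close>. Conjoining
  the formula responsible for this yields a witness in \<open>n\<close> variables for which \<open>\<phi>(x, a\<^sub>\<eta>)\<close> has
  at most \<open>k\<close> solutions in \<open>x\<^sub>i\<close>, whatever the other coordinates are
  (\<open>bounded_witness_of_acl\<close>). Take \<open>k\<close> minimal, let \<open>b\<close> realize this new witness along \<open>X\<close>, and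
  let \<open>S\<^sub>\<eta>\<close> be the finite set of solutions of \<open>\<phi>(x, a\<^sub>\<eta>)\<close> in \<open>x\<^sub>i\<close>, the other coordinates being
  those of \<open>b\<close>. If \<open>S\<^sub>\<zeta>\<close> were not contained in \<open>S\<^sub>\<eta>\<close> for some \<open>\<zeta>, \<eta> \<in> X\<close>, then \<open>S\<^sub>\<zeta> \<inter> S\<^sub>\<eta>\<close>
  would have fewer than \<open>k\<close> elements, and conjoining \<open>\<phi>(x, a\<^sub>\<zeta>) \<and> \<phi>(x, a\<^sub>\<eta>)\<close> would give a smaller
  bound. So, for a fixed \<open>\<zeta> \<in> X\<close>, the formula ``\<open>S\<^sub>\<zeta>\<close> is nonempty and contained in \<open>S\<^sub>\<eta>\<close>'', in which
  \<open>x\<^sub>i\<close> is quantified away, holds for all \<open>\<eta> \<in> X\<close>. Whenever it holds for all \<open>\<eta>\<close> in some set,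
  any element of \<open>S\<^sub>\<zeta>\<close> is a common solution of the \<open>\<phi>(x, a\<^sub>\<eta>)\<close>. It is therefore a witness in
  \<open>n - 1\<close> variables (\<open>eliminate_bounded_variable\<close>), contradicting the choice of \<open>n\<close>.
\<close>

section \<open>Formula constructions\<close>

lemma finite_tvars: "finite (tvars t)"
  by (induction t) auto

lemma finite_fvars: "finite (fvars \<phi>)"
  by (induction \<phi>) (auto simp: finite_tvars)

lemma val_cong: "(\<And>i. i \<in> tvars t \<Longrightarrow> v i = w i) \<Longrightarrow> val M v t = val M w t"
proof (induction t)
  case (App f ts)
  have "map (val M v) ts = map (val M w) ts"
    using App by (intro map_cong) auto
  then show ?case by (simp only: val.simps)
qed simp

lemma sat_cong: "(\<And>i. i \<in> fvars \<phi> \<Longrightarrow> v i = w i) \<Longrightarrow> sat M v \<phi> = sat M w \<phi>"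
proof (induction \<phi> arbitrary: v w)
  case (Eq s t)
  then show ?case using val_cong[of s v w M] val_cong[of t v w M] by simp
next
  case (Rel r ts)
  have "map (val M v) ts = map (val M w) ts"
    using Rel by (intro map_cong refl val_cong) auto
  then show ?case by (simp only: sat.simps)
next
  case (Neg p)
  then show ?case by (metis fvars.simps(3) sat.simps(3))
next
  case (Conj p q)
  then show ?case by (metis UnCI fvars.simps(4) sat.simps(4))
next
  case (Ex i p)
  have "sat M (v(i := a)) p = sat M (w(i := a)) p" for a
    using Ex.prems by (intro Ex.IH) auto
  then show ?case by simp
qed

definition fresh :: "nat set \<Rightarrow> nat" where
  "fresh S = (SOME k. k \<notin> S)"

lemma fresh_notin: "finite S \<Longrightarrow> fresh S \<notin> S"
  unfolding fresh_def by (rule someI_ex) (rule ex_new_if_finite[OF infinite_UNIV_nat])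

fun ren_trm :: "(nat \<Rightarrow> nat) \<Rightarrow> 'f trm \<Rightarrow> 'f trm" where
  "ren_trm \<rho> (Var i) = Var (\<rho> i)"
| "ren_trm \<rho> (App f ts) = App f (map (ren_trm \<rho>) ts)"

text \<open>
  Substitution of variables for variables. The substitution may be non-injective, so each bound
  variable is replaced by one that avoids the images of the free variables.
\<close>

fun ren :: "(nat \<Rightarrow> nat) \<Rightarrow> ('f, 'r) fm \<Rightarrow> ('f, 'r) fm" where
  "ren \<rho> (Eq s t) = Eq (ren_trm \<rho> s) (ren_trm \<rho> t)"
| "ren \<rho> (Rel r ts) = Rel r (map (ren_trm \<rho>) ts)"
| "ren \<rho> (Neg p) = Neg (ren \<rho> p)"
| "ren \<rho> (Conj p q) = Conj (ren \<rho> p) (ren \<rho> q)"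
| "ren \<rho> (Ex i p) =
     (let k = fresh (\<rho> ` (fvars p - {i})) in Ex k (ren (\<rho>(i := k)) p))"

lemma wf_ren_trm: "wf_trm L t \<Longrightarrow> wf_trm L (ren_trm \<rho> t)"
  by (induction t) auto

lemma wf_ren: "wf_fm L \<phi> \<Longrightarrow> wf_fm L (ren \<rho> \<phi>)"
  by (induction \<phi> arbitrary: \<rho>) (auto simp: wf_ren_trm Let_def)

lemma tvars_ren_trm: "tvars (ren_trm \<rho> t) = \<rho> ` tvars t"
  by (induction t) auto

lemma fvars_ren: "fvars (ren \<rho> \<phi>) = \<rho> ` fvars \<phi>"
proof (induction \<phi> arbitrary: \<rho>)
  case (Ex i p)
  define k where "k = fresh (\<rho> ` (fvars p - {i}))"
  have "k \<notin> \<rho> ` (fvars p - {i})"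
    unfolding k_def by (rule fresh_notin) (simp add: finite_fvars)
  then have "(\<rho>(i := k)) ` fvars p - {k} = \<rho> ` (fvars p - {i})"
    by (auto simp: image_iff)
  then show ?case by (simp add: Let_def Ex.IH flip: k_def)
qed (auto simp: tvars_ren_trm)

lemma val_ren_trm: "val M v (ren_trm \<rho> t) = val M (\<lambda>i. v (\<rho> i)) t"
proof (induction t)
  case (App f ts)
  have "map (val M v \<circ> ren_trm \<rho>) ts = map (val M (\<lambda>i. v (\<rho> i))) ts"
    using App by (intro map_cong) auto
  then show ?case by (simp only: val.simps ren_trm.simps map_map)
qed simp

lemma sat_ren: "sat M v (ren \<rho> \<phi>) = sat M (\<lambda>i. v (\<rho> i)) \<phi>"
proof (induction \<phi> arbitrary: v \<rho>)
  case (Rel r ts)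
  have "map (val M v \<circ> ren_trm \<rho>) ts = map (val M (\<lambda>i. v (\<rho> i))) ts"
    by (intro map_cong) (auto simp: val_ren_trm)
  then show ?case by (simp only: sat.simps ren.simps map_map)
next
  case (Ex i p)
  define k where "k = fresh (\<rho> ` (fvars p - {i}))"
  have k: "k \<notin> \<rho> ` (fvars p - {i})"
    unfolding k_def by (rule fresh_notin) (simp add: finite_fvars)
  have "sat M (\<lambda>j. (v(k := a)) ((\<rho>(i := k)) j)) p = sat M ((\<lambda>j. v (\<rho> j))(i := a)) p" for a
    using k by (intro sat_cong) (auto simp: image_iff)
  then show ?case by (simp add: Let_def Ex.IH flip: k_def)
qed (auto simp: val_ren_trm)

fun conjs :: "('f, 'r) fm list \<Rightarrow> ('f, 'r) fm" where
  "conjs [] = Neg (Ex 0 (Neg (Eq (Var 0) (Var 0))))"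
| "conjs (p # ps) = Conj p (conjs ps)"

lemma sat_conjs: "sat M v (conjs ps) \<longleftrightarrow> (\<forall>p\<in>set ps. sat M v p)"
  by (induction ps) auto

lemma wf_conjs: "wf_fm L (conjs ps) \<longleftrightarrow> (\<forall>p\<in>set ps. wf_fm L p)"
  by (induction ps) auto

lemma fvars_conjs: "fvars (conjs ps) = (\<Union>p\<in>set ps. fvars p)"
  by (induction ps) auto

text \<open>
  The new quantifier goes innermost: the block then binds \<open>0, \<dots>, n - 1\<close> in this order,
  which matches a tuple growing at its end.
\<close>

fun exs :: "nat \<Rightarrow> ('f, 'r) fm \<Rightarrow> ('f, 'r) fm" where
  "exs 0 p = p"
| "exs (Suc n) p = exs n (Ex n p)"

lemma wf_exs: "wf_fm L (exs n p) = wf_fm L p"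
  by (induction n arbitrary: p) auto

lemma fvars_exs: "fvars (exs n p) = fvars p - {..<n}"
  by (induction n arbitrary: p) (auto simp: lessThan_Suc)

lemma sat_exs:
  "sat M v (exs n p) \<longleftrightarrow> (\<exists>xs\<in>tuples M n. sat M (\<lambda>i. if i < n then xs ! i else v i) p)"
proof (induction n arbitrary: p)
  case 0
  then show ?case by (auto simp: tuples_def)
next
  case (Suc n)
  have upd: "(\<lambda>i. if i < n then xs ! i else v i)(n := a)
      = (\<lambda>i. if i < Suc n then (xs @ [a]) ! i else v i)" if "length xs = n" for xs a
    using that by (auto simp: nth_append fun_eq_iff)
  have snoc: "(\<exists>xs\<in>tuples M n. \<exists>a\<in>carr M. Q (xs @ [a])) \<longleftrightarrow> (\<exists>xs\<in>tuples M (Suc n). Q xs)" for Q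
  proof
    assume "\<exists>xs\<in>tuples M (Suc n). Q xs"
    then obtain xs where xs: "xs \<in> tuples M (Suc n)" "Q xs" by blast
    from xs(1) have "xs \<noteq> []" "butlast xs \<in> tuples M n" "last xs \<in> carr M"
      by (auto simp: tuples_def dest: in_set_butlastD)
        (metis last_in_set length_greater_0_conv subsetD zero_less_Suc)
    then show "\<exists>xs\<in>tuples M n. \<exists>a\<in>carr M. Q (xs @ [a])"
      using xs(2) by (metis append_butlast_last_id)
  next
    assume "\<exists>xs\<in>tuples M n. \<exists>a\<in>carr M. Q (xs @ [a])"
    then obtain xs a where "xs \<in> tuples M n" "a \<in> carr M" "Q (xs @ [a])" by blast
    then show "\<exists>xs\<in>tuples M (Suc n). Q xs"
      by (intro bexI[of _ "xs @ [a]"]) (auto simp: tuples_def)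
  qed
  have "sat M v (exs (Suc n) p) \<longleftrightarrow>
      (\<exists>xs\<in>tuples M n. \<exists>a\<in>carr M. sat M (\<lambda>i. if i < Suc n then (xs @ [a]) ! i else v i) p)"
    unfolding exs.simps Suc.IH sat.simps by (intro bex_cong refl) (simp add: upd tuples_def)
  also have "\<dots> \<longleftrightarrow> (\<exists>xs\<in>tuples M (Suc n). sat M (\<lambda>i. if i < Suc n then xs ! i else v i) p)"
    by (rule snoc)
  finally show ?case .
qed

text \<open>
  Counting by removal: a set has at most \<open>k + 1\<close> elements iff it has at most \<open>k\<close> after the
  removal of a suitable \<open>z\<close>. So \<open>p\<close> occurs only once, and no copies of it need be renamed.
\<close>

fun atmost :: "nat \<Rightarrow> nat \<Rightarrow> ('f, 'r) fm \<Rightarrow> ('f, 'r) fm" where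
  "atmost 0 i p = Neg (Ex i p)"
| "atmost (Suc k) i p =
     (let z = fresh (insert i (fvars p)) in Ex z (atmost k i (Conj p (Neg (Eq (Var i) (Var z))))))"

lemma wf_atmost: "wf_fm L p \<Longrightarrow> wf_fm L (atmost k i p)"
  by (induction k arbitrary: p) (auto simp: Let_def)

lemma fvars_atmost: "fvars (atmost k i p) \<subseteq> fvars p - {i}"
proof (induction k arbitrary: p)
  case (Suc k)
  define z where "z = fresh (insert i (fvars p))"
  have "fvars (atmost k i (Conj p (Neg (Eq (Var i) (Var z))))) - {z} \<subseteq> fvars p - {i}"
    using Suc.IH by fastforce
  then show ?case by (simp add: Let_def flip: z_def)
qed simp

lemma sat_atmost:
  assumes "carr M \<noteq> {}"
  shows "sat M v (atmost k i p) \<longleftrightarrow>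
    finite {c \<in> carr M. sat M (v(i := c)) p} \<and> card {c \<in> carr M. sat M (v(i := c)) p} \<le> k"
proof (induction k arbitrary: v p)
  case 0
  show ?case
  proof (cases "\<exists>a\<in>carr M. sat M (v(i := a)) p")
    case True
    then show ?thesis by (auto simp: card_eq_0_iff simp del: fun_upd_apply)
  next
    case False
    then have "{c \<in> carr M. sat M (v(i := c)) p} = {}" by blast
    moreover have "sat M v (atmost 0 i p)" using False by (simp del: fun_upd_apply)
    ultimately show ?thesis by (simp only: finite.emptyI card.empty le_refl simp_thms)
  qed
next
  case (Suc k)
  define z where "z = fresh (insert i (fvars p))"
  define S where "S = {c \<in> carr M. sat M (v(i := c)) p}"
  have z: "z \<noteq> i" "z \<notin> fvars p"
    using fresh_notin[of "insert i (fvars p)"] unfolding z_def by (auto simp: finite_fvars)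
  have "sat M (v(z := d, i := c)) p = sat M (v(i := c)) p" for c d
    using z by (intro sat_cong) auto
  then have "{c \<in> carr M. sat M (v(z := d, i := c)) (Conj p (Neg (Eq (Var i) (Var z))))} = S - {d}"
    for d
    using z by (auto simp: S_def)
  then have "sat M v (atmost (Suc k) i p) \<longleftrightarrow> (\<exists>d\<in>carr M. finite (S - {d}) \<and> card (S - {d}) \<le> k)"
    unfolding atmost.simps Let_def z_def[symmetric] sat.simps(5) Suc.IH by (auto simp del: sat.simps)
  also have "\<dots> \<longleftrightarrow> finite S \<and> card S \<le> Suc k"
  proof
    assume "\<exists>d\<in>carr M. finite (S - {d}) \<and> card (S - {d}) \<le> k"
    then obtain d where "finite (S - {d})" "card (S - {d}) \<le> k" by blast
    then show "finite S \<and> card S \<le> Suc k"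
      by (metis card_Diff1_le card_Suc_Diff1 finite_Diff_insert finite.emptyI Diff_empty
          Diff_insert0 Suc_le_mono le_SucI)
  next
    assume S: "finite S \<and> card S \<le> Suc k"
    show "\<exists>d\<in>carr M. finite (S - {d}) \<and> card (S - {d}) \<le> k"
    proof (cases "S = {}")
      case True
      then show ?thesis using assms by auto
    next
      case False
      then obtain d where "d \<in> S" by blast
      then show ?thesis using S by (intro bexI[of _ d]) (auto simp: S_def)
    qed
  qed
  finally show ?case by (simp only: S_def)
qed

lemma fmls_ren:
  assumes "\<phi> \<in> fmls L n" and "\<And>i. i < n \<Longrightarrow> \<rho> i < m"
  shows "ren \<rho> \<phi> \<in> fmls L m"
  using assms by (auto simp: fmls_def wf_ren fvars_ren)

lemma holds_ren:
  assumes "\<phi> \<in> fmls L (length ys)" and "\<And>i. i < length ys \<Longrightarrow> xs ! \<rho> i = ys ! i"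
  shows "holds M (ren \<rho> \<phi>) xs = holds M \<phi> ys"
  unfolding holds_def sat_ren using assms by (intro sat_cong) (auto simp: fmls_def)

section \<open>Elementary relations\<close>

text \<open>
  A partial elementary map given by its graph \<open>G\<close>. Being formulated with assignments into
  \<open>G\<close> it is monotone and of finite character in \<open>G\<close>, and it disregards how tuples are
  enumerated: equality of the types of two tuples becomes the statement about the set of pairs of
  corresponding entries.
\<close>

definition elem_map ::
  "('f, 'r) lang \<Rightarrow> ('f, 'r, 'a) struct \<Rightarrow> ('f, 'r, 'b) struct \<Rightarrow> ('a \<times> 'b) set \<Rightarrow> bool" where
  "elem_map L N M G \<longleftrightarrow> (\<forall>\<phi> v. wf_fm L \<phi> \<and> v ` fvars \<phi> \<subseteq> G \<longrightarrow>
     sat N (\<lambda>i. fst (v i)) \<phi> = sat M (\<lambda>i. snd (v i)) \<phi>)"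

lemma elem_map_mono: "elem_map L N M G \<Longrightarrow> H \<subseteq> G \<Longrightarrow> elem_map L N M H"
  unfolding elem_map_def by blast

lemma elem_map_holds:
  assumes "elem_map L N M G" "\<phi> \<in> fmls L (length xs)" "length ys = length xs"
    and "set (zip xs ys) \<subseteq> G"
  shows "holds N \<phi> xs = holds M \<phi> ys"
proof -
  let ?v = "\<lambda>i. (xs ! i, ys ! i)"
  have "?v ` fvars \<phi> \<subseteq> G"
    using assms(2-4) by (force simp: fmls_def set_zip)
  then show ?thesis
    using assms(1,2) unfolding elem_map_def holds_def fmls_def by fastforce
qed

lemma elem_map_zipI:
  assumes len: "length ys = length xs"
    and eq: "\<And>\<phi>. \<phi> \<in> fmls L (length xs) \<Longrightarrow> holds N \<phi> xs = holds M \<phi> ys"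
  shows "elem_map L N M (set (zip xs ys))"
  unfolding elem_map_def
proof (intro allI impI)
  fix \<phi> and v :: "nat \<Rightarrow> _"
  assume "wf_fm L \<phi> \<and> v ` fvars \<phi> \<subseteq> set (zip xs ys)"
  then have wf: "wf_fm L \<phi>" and v: "\<And>i. i \<in> fvars \<phi> \<Longrightarrow> v i \<in> set (zip xs ys)"
    by auto
  have "\<forall>i\<in>fvars \<phi>. \<exists>j. j < length xs \<and> v i = (xs ! j, ys ! j)"
    using v len by (fastforce simp: set_zip)
  then obtain \<rho> where \<rho>: "\<And>i. i \<in> fvars \<phi> \<Longrightarrow> \<rho> i < length xs \<and> v i = (xs ! \<rho> i, ys ! \<rho> i)"
    by metis
  have "ren \<rho> \<phi> \<in> fmls L (length xs)"
    using wf \<rho> by (auto simp: fmls_def wf_ren fvars_ren)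
  from eq[OF this] have "sat N (\<lambda>i. xs ! \<rho> i) \<phi> = sat M (\<lambda>i. ys ! \<rho> i) \<phi>"
    by (simp add: holds_def sat_ren)
  moreover have "sat N (\<lambda>i. xs ! \<rho> i) \<phi> = sat N (\<lambda>i. fst (v i)) \<phi>"
    "sat M (\<lambda>i. ys ! \<rho> i) \<phi> = sat M (\<lambda>i. snd (v i)) \<phi>"
    using \<rho> by (auto intro!: sat_cong)
  ultimately show "sat N (\<lambda>i. fst (v i)) \<phi> = sat M (\<lambda>i. snd (v i)) \<phi>"
    by simp
qed

lemma tp_empty_eq_iff:
  assumes len: "length ys = length xs"
  shows "tp L M {} xs = tp L M {} ys \<longleftrightarrow> elem_map L M M (set (zip xs ys))"
proof
  assume eq: "tp L M {} xs = tp L M {} ys"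
  have "holds M \<phi> xs = holds M \<phi> ys" if "\<phi> \<in> fmls L (length xs)" for \<phi>
  proof -
    have "(\<phi>, []) \<in> tp L M {} xs \<longleftrightarrow> (\<phi>, []) \<in> tp L M {} ys" by (simp only: eq)
    then show ?thesis using that len by (simp add: tp_def pfmls_def)
  qed
  then show "elem_map L M M (set (zip xs ys))"
    using len by (intro elem_map_zipI)
next
  assume em: "elem_map L M M (set (zip xs ys))"
  show "tp L M {} xs = tp L M {} ys"
    using elem_map_holds[OF em _ len] len by (auto simp: tp_def pfmls_def)
qed

text \<open>
  Joint realizability of finitely many formulas is itself a first-order condition on their
  parameters, so elementary maps preserve it. To express it by a single formula, the parameter
  variables of the \<open>l\<close>-th formula are made disjoint from all others by the pairing function.
\<close>

lemma elem_map_realizes: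
  fixes q :: "(('f, 'r) fm \<times> 'a list \<times> 'b list) set"
  assumes em: "elem_map L N M G" and "finite q"
    and q: "\<And>\<phi> as bs. (\<phi>, as, bs) \<in> q \<Longrightarrow>
      length bs = length as \<and> \<phi> \<in> fmls L (n + length as) \<and> set (zip as bs) \<subseteq> G"
    and ex: "\<exists>xs\<in>tuples N n. \<forall>(\<phi>, as, bs)\<in>q. holds N \<phi> (xs @ as)"
  shows "\<exists>xs\<in>tuples M n. \<forall>(\<phi>, as, bs)\<in>q. holds M \<phi> (xs @ bs)"
proof -
  obtain ls where ls: "set ls = q"
    using \<open>finite q\<close> finite_list by blast
  define F where "F = (\<lambda>l. fst (ls ! l))"
  define A where "A = (\<lambda>l. fst (snd (ls ! l)))"
  define B where "B = (\<lambda>l. snd (snd (ls ! l)))"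
  define \<rho> where "\<rho> = (\<lambda>l i. if i < n then i else n + prod_encode (l, i - n))"
  define v where "v = (\<lambda>x. case prod_decode (x - n) of (l, j) \<Rightarrow> (A l ! j, B l ! j))"
  define \<Psi> where "\<Psi> = conjs (map (\<lambda>l. ren (\<rho> l) (F l)) [0..<length ls])"
  have l: "length (B l) = length (A l)" "F l \<in> fmls L (n + length (A l))"
      "set (zip (A l) (B l)) \<subseteq> G" "(F l, A l, B l) \<in> q" if "l < length ls" for l
  proof -
    show "(F l, A l, B l) \<in> q"
      using that ls nth_mem by (fastforce simp: A_def B_def F_def)
    from q[OF this] show "length (B l) = length (A l)" "F l \<in> fmls L (n + length (A l))"
      "set (zip (A l) (B l)) \<subseteq> G" by auto
  qed
  have v: "v (\<rho> l i) = (A l ! (i - n), B l ! (i - n))" if "\<not> i < n" for l i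
    using that by (simp add: v_def \<rho>_def)
  have vG: "v ` fvars (exs n \<Psi>) \<subseteq> G"
  proof
    fix y assume "y \<in> v ` fvars (exs n \<Psi>)"
    then obtain l i where li: "l < length ls" "i \<in> fvars (F l)" "y = v (\<rho> l i)" "\<not> \<rho> l i < n"
      by (fastforce simp: fvars_exs \<Psi>_def fvars_conjs fvars_ren)
    then have "\<not> i < n" by (auto simp: \<rho>_def split: if_splits)
    moreover have "i < n + length (A l)" using l(2)[OF li(1)] li(2) by (auto simp: fmls_def)
    ultimately have "(A l ! (i - n), B l ! (i - n)) \<in> set (zip (A l) (B l))"
      using l(1)[OF li(1)] by (auto simp: set_zip intro!: exI[of _ "i - n"])
    then show "y \<in> G" using l(3)[OF li(1)] v[OF \<open>\<not> i < n\<close>] li(3) by auto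
  qed
  have wf: "wf_fm L (exs n \<Psi>)"
    using l(2) by (auto simp: wf_exs \<Psi>_def wf_conjs fmls_def intro!: wf_ren)
  have satA: "sat N (\<lambda>i. if i < n then xs ! i else fst (v i)) \<Psi> \<longleftrightarrow>
      (\<forall>l<length ls. holds N (F l) (xs @ A l))" if "xs \<in> tuples N n" for xs
  proof -
    have "sat N (\<lambda>j. if \<rho> l j < n then xs ! \<rho> l j else fst (v (\<rho> l j))) (F l)
        = holds N (F l) (xs @ A l)" for l
      unfolding holds_def using that v
      by (intro sat_cong) (auto simp: \<rho>_def nth_append tuples_def)
    then show ?thesis by (auto simp: \<Psi>_def sat_conjs sat_ren)
  qed
  have satB: "sat M (\<lambda>i. if i < n then xs ! i else snd (v i)) \<Psi> \<longleftrightarrow>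
      (\<forall>l<length ls. holds M (F l) (xs @ B l))" if "xs \<in> tuples M n" for xs
  proof -
    have "sat M (\<lambda>j. if \<rho> l j < n then xs ! \<rho> l j else snd (v (\<rho> l j))) (F l)
        = holds M (F l) (xs @ B l)" for l
      unfolding holds_def using that v
      by (intro sat_cong) (auto simp: \<rho>_def nth_append tuples_def)
    then show ?thesis by (auto simp: \<Psi>_def sat_conjs sat_ren)
  qed
  have "sat N (\<lambda>i. fst (v i)) (exs n \<Psi>)"
  proof -
    obtain xs where xs: "xs \<in> tuples N n" "\<forall>(\<phi>, as, bs)\<in>q. holds N \<phi> (xs @ as)"
      using ex by blast
    then have "\<forall>l<length ls. holds N (F l) (xs @ A l)" using l(4) by blast
    then show ?thesis unfolding sat_exs using satA xs(1) by blast
  qed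
  then have "sat M (\<lambda>i. snd (v i)) (exs n \<Psi>)"
    using em wf vG unfolding elem_map_def by blast
  then obtain xs where xs: "xs \<in> tuples M n" "\<forall>l<length ls. holds M (F l) (xs @ B l)"
    unfolding sat_exs using satB by blast
  have "holds M \<phi> (xs @ bs)" if "(\<phi>, as, bs) \<in> q" for \<phi> as bs
  proof -
    have "(\<phi>, as, bs) \<in> set ls" using that ls by simp
    then obtain l where "l < length ls" "ls ! l = (\<phi>, as, bs)"
      unfolding in_set_conv_nth by blast
    then show ?thesis using xs(2) by (auto simp: F_def B_def)
  qed
  then show ?thesis using xs(1) by auto
qed


section \<open>Elementary equivalence of the models of a complete theory\<close>

lemma val_embedding:
  assumes emb: "embedding L M N h" and M: "is_struct L M"
    and "wf_trm L t" and "v ` tvars t \<subseteq> carr M"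
  shows "val M v t \<in> carr M \<and> val N (\<lambda>i. h (v i)) t = h (val M v t)"
  using assms(3,4)
proof (induction t)
  case (App f ts)
  have ts: "val M v t \<in> carr M \<and> val N (\<lambda>i. h (v i)) t = h (val M v t)" if "t \<in> set ts" for t
    using that App.prems by (intro App.IH) auto
  then have tup: "map (val M v) ts \<in> tuples M (far L f)"
    using App.prems by (auto simp: tuples_def)
  have "map (val N (\<lambda>i. h (v i))) ts = map h (map (val M v) ts)"
    using ts by simp
  moreover have "h (fn M f (map (val M v) ts)) = fn N f (map h (map (val M v) ts))"
    "fn M f (map (val M v) ts) \<in> carr M"
    using emb M App.prems(1) tup unfolding embedding_def is_struct_def by auto
  ultimately show ?case by (simp only: val.simps)
qed simp

lemma sat_embedding:
  assumes emb: "embedding L M N h" and M: "is_struct L M"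
    and "wf_fm L \<phi>" and "v ` fvars \<phi> \<subseteq> carr M" and "qfree \<phi> \<or> h ` carr M = carr N"
  shows "sat N (\<lambda>i. h (v i)) \<phi> = sat M v \<phi>"
  using assms(3-5)
proof (induction \<phi> arbitrary: v)
  case (Eq s t)
  have "val M v s \<in> carr M \<and> val N (\<lambda>i. h (v i)) s = h (val M v s)"
    "val M v t \<in> carr M \<and> val N (\<lambda>i. h (v i)) t = h (val M v t)"
    using Eq by (auto intro!: val_embedding[OF emb M])
  moreover have "inj_on h (carr M)" using emb by (simp add: embedding_def)
  ultimately show ?case by (auto dest: inj_onD)
next
  case (Rel r ts)
  have ts: "val M v t \<in> carr M \<and> val N (\<lambda>i. h (v i)) t = h (val M v t)" if "t \<in> set ts" for t
    using that Rel by (auto intro!: val_embedding[OF emb M])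
  then have tup: "map (val M v) ts \<in> tuples M (rar L r)"
    using Rel.prems by (auto simp: tuples_def)
  have "map (val N (\<lambda>i. h (v i))) ts = map h (map (val M v) ts)"
    using ts by simp
  moreover have "rel M r (map (val M v) ts) = rel N r (map h (map (val M v) ts))"
    using emb Rel.prems(1) tup unfolding embedding_def by auto
  ultimately show ?case by (simp only: sat.simps)
next
  case (Ex i p)
  then have surj: "h ` carr M = carr N" by simp
  have "sat N (\<lambda>j. h ((v(i := a)) j)) p = sat M (v(i := a)) p" if "a \<in> carr M" for a
    using that Ex.prems by (intro Ex.IH) auto
  moreover have "(\<lambda>j. h (v j))(i := h a) = (\<lambda>j. h ((v(i := a)) j))" for a
    by auto
  ultimately show ?case
    unfolding sat.simps surj[symmetric] by simp
qed auto

text \<open>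
  Downward Loewenheim-Skolem, in the form needed to compare models over arbitrary types with the
  models over the type of formulas. The Skolem hull of the empty set is the range of an evaluation
  of closed Skolem terms; such terms embed into formulas, and so does the hull. One function symbol
  is used for every formula \<open>\<exists>x\<^sub>i. p\<close>, its arguments being the values of the variables
  \<open>0, 1, \<dots>\<close>.
\<close>

datatype ('f, 'r) skolem_term = Skolem "('f, 'r) fm" "('f, 'r) skolem_term list"

text \<open>
  The value is any element of the carrier if \<open>\<psi>\<close> is not an existential formula or has no
  solution; this keeps the evaluation of Skolem terms total.
\<close>

definition skolem_witness :: "('f, 'r, 'a) struct \<Rightarrow> ('f, 'r) fm \<Rightarrow> 'a list \<Rightarrow> 'a" where
  "skolem_witness N \<psi> as = (SOME a. a \<in> carr N \<and> (\<forall>i p. \<psi> = Ex i p \<longrightarrow>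
     (\<exists>c\<in>carr N. sat N (((!) as)(i := c)) p) \<longrightarrow> sat N (((!) as)(i := a)) p))"

lemma skolem_witness:
  assumes "carr N \<noteq> {}"
  shows "skolem_witness N \<psi> as \<in> carr N"
    and "\<lbrakk>c \<in> carr N; sat N (((!) as)(i := c)) p\<rbrakk> \<Longrightarrow>
      sat N (((!) as)(i := skolem_witness N (Ex i p) as)) p"
proof -
  let ?P = "\<lambda>\<psi> a. a \<in> carr N \<and> (\<forall>i p. \<psi> = Ex i p \<longrightarrow>
     (\<exists>c\<in>carr N. sat N (((!) as)(i := c)) p) \<longrightarrow> sat N (((!) as)(i := a)) p)"
  have "\<exists>a. ?P \<psi> a" for \<psi>
    using assms by (cases \<psi>) (auto simp del: fun_upd_apply)
  then have *: "?P \<psi> (skolem_witness N \<psi> as)" for \<psi>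
    unfolding skolem_witness_def by (rule someI_ex)
  show "skolem_witness N \<psi> as \<in> carr N" using * by blast
  show "\<lbrakk>c \<in> carr N; sat N (((!) as)(i := c)) p\<rbrakk> \<Longrightarrow>
      sat N (((!) as)(i := skolem_witness N (Ex i p) as)) p"
    using * by blast
qed

primrec skolem_val :: "('f, 'r, 'a) struct \<Rightarrow> ('f, 'r) skolem_term \<Rightarrow> 'a" where
  "skolem_val N (Skolem \<psi> ts) = skolem_witness N \<psi> (map (skolem_val N) ts)"

primrec skolem_code :: "('f, 'r) skolem_term \<Rightarrow> ('f, 'r) fm" where
  "skolem_code (Skolem \<psi> ts) = Conj \<psi> (foldr Conj (map skolem_code ts) (Eq (Var 0) (Var 0)))"

lemma inj_skolem_code: "inj skolem_code"
proof (rule injI)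
  fix s t :: "('f, 'r) skolem_term"
  show "skolem_code s = skolem_code t \<Longrightarrow> s = t"
  proof (induction s arbitrary: t)
    case (Skolem \<psi> ss)
    obtain \<chi> ts where t: "t = Skolem \<chi> ts" by (cases t)
    have "ss = ts" if "foldr Conj (map skolem_code ss) (Eq (Var 0) (Var 0))
        = foldr Conj (map skolem_code ts) (Eq (Var 0) (Var 0))"
      using that Skolem.IH
    proof (induction ss arbitrary: ts)
      case Nil
      then show ?case by (cases ts) auto
    next
      case (Cons s ss)
      then obtain t us where ts: "ts = t # us" by (cases ts) auto
      then have "s = t" using Cons.prems by simp
      moreover have "ss = us" using Cons.prems ts by (intro Cons.IH) auto
      ultimately show ?case using ts by simp
    qed
    then show ?case using Skolem.prems t by simp
  qed
qed

definition skolem_hull :: "('f, 'r, 'a) struct \<Rightarrow> ('f, 'r, 'a) struct" where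
  "skolem_hull N = N\<lparr>carr := range (skolem_val N)\<rparr>"

lemma skolem_witness_in_hull:
  assumes "set as \<subseteq> range (skolem_val N)"
  shows "skolem_witness N \<psi> as \<in> range (skolem_val N)"
proof -
  have "\<exists>ts. as = map (skolem_val N) ts"
    using assms by (metis ex_map_conv subset_iff imageE)
  then obtain ts where "as = map (skolem_val N) ts" ..
  then have "skolem_witness N \<psi> as = skolem_val N (Skolem \<psi> ts)" by simp
  then show ?thesis by (metis rangeI)
qed

lemma skolem_val_carr:
  assumes "carr N \<noteq> {}"
  shows "skolem_val N t \<in> carr N"
  using assms by (cases t) (simp add: skolem_witness(1))

lemma val_skolem_hull: "val (skolem_hull N) v t = val N v t"
proof (induction t)
  case (App f ts)
  then have "map (val (skolem_hull N) v) ts = map (val N v) ts" by (intro map_cong) auto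
  then show ?case by (simp only: val.simps) (simp add: skolem_hull_def)
qed simp

text \<open>
  The Tarski-Vaught test: by construction the hull contains a solution, if there is one, of every
  existential formula with parameters in the hull.
\<close>

lemma sat_skolem_hull:
  assumes N: "carr N \<noteq> {}" and "range v \<subseteq> range (skolem_val N)"
  shows "sat (skolem_hull N) v \<phi> = sat N v \<phi>"
  using assms(2)
proof (induction \<phi> arbitrary: v)
  case (Rel r ts)
  have "map (val (skolem_hull N) v) ts = map (val N v) ts"
    by (simp add: val_skolem_hull)
  then show ?case by (simp only: sat.simps) (simp add: skolem_hull_def)
next
  case (Ex i p)
  have IH: "sat (skolem_hull N) (v(i := a)) p = sat N (v(i := a)) p"
    if "a \<in> range (skolem_val N)" for a
    using that Ex.prems by (intro Ex.IH) auto
  have "\<exists>a\<in>range (skolem_val N). sat N (v(i := a)) p" if c: "c \<in> carr N" "sat N (v(i := c)) p" for c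
  proof -
    obtain B where B: "\<forall>j\<in>fvars p. j < B"
      using finite_nat_set_iff_bounded finite_fvars by blast
    let ?as = "map v [0..<B]"
    have eq: "sat N (((!) ?as)(i := a)) p = sat N (v(i := a)) p" for a
      using B by (intro sat_cong) auto
    have "sat N (((!) ?as)(i := skolem_witness N (Ex i p) ?as)) p"
      using c eq by (intro skolem_witness(2)[OF N]) auto
    moreover have "skolem_witness N (Ex i p) ?as \<in> range (skolem_val N)"
      using Ex.prems by (intro skolem_witness_in_hull) auto
    ultimately show ?thesis using eq by blast
  qed
  moreover have "range (skolem_val N) \<subseteq> carr N" using skolem_val_carr[OF N] by blast
  moreover have "carr (skolem_hull N) = range (skolem_val N)" by (simp add: skolem_hull_def)
  ultimately show ?case
    using IH unfolding sat.simps by (metis subsetD)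
qed (simp_all add: val_skolem_hull)

text \<open>
  The hull is closed under a function \<open>f\<close> because \<open>f(xs)\<close> is the only solution of
  \<open>\<exists>x. x = f(xs)\<close>.
\<close>

lemma is_struct_skolem_hull:
  assumes N: "is_struct L N"
  shows "is_struct L (skolem_hull N)"
proof -
  have ne: "carr N \<noteq> {}" using N by (simp add: is_struct_def)
  have "fn N f xs \<in> range (skolem_val N)"
    if f: "f \<in> funs L" and xs: "length xs = far L f" "set xs \<subseteq> range (skolem_val N)" for f xs
  proof -
    let ?n = "length xs"
    let ?p = "Eq (Var ?n) (App f (map Var [0..<?n]))"
    have "map (val N (((!) xs)(?n := a))) (map Var [0..<?n]) = xs" for a
      by (intro nth_equalityI) auto
    then have eq: "sat N (((!) xs)(?n := a)) ?p \<longleftrightarrow> a = fn N f xs" for a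
      by (simp only: sat.simps val.simps fun_upd_same)
    have "fn N f xs \<in> carr N"
      using N f xs skolem_val_carr[OF ne] by (fastforce simp: is_struct_def tuples_def)
    from skolem_witness(2)[OF ne this, of xs ?n ?p]
    have "skolem_witness N (Ex ?n ?p) xs = fn N f xs"
      using eq by simp
    then show ?thesis using skolem_witness_in_hull[OF xs(2)] by metis
  qed
  then show ?thesis
    by (auto simp: is_struct_def skolem_hull_def tuples_def)
qed

lemma isomorphic_copy:
  assumes N: "is_struct L N" and inj: "inj_on c (carr N)"
  obtains N' where "is_struct L N'" "isomorphism L N N' c"
proof -
  define d where "d = inv_into (carr N) c"
  define N' where "N' = \<lparr>carr = c ` carr N, fn = (\<lambda>f ys. c (fn N f (map d ys))),
    rel = (\<lambda>r ys. rel N r (map d ys))\<rparr>"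
  have d: "d (c x) = x" if "x \<in> carr N" for x
    using that inj by (simp add: d_def)
  then have dm: "map d (map c xs) = xs" if "set xs \<subseteq> carr N" for xs
    using that by (induction xs) auto
  have "\<exists>xs. ys = map c xs \<and> set xs \<subseteq> carr N" if "set ys \<subseteq> c ` carr N" for ys
    using that by (intro exI[of _ "map d ys"]) (auto simp: d intro!: map_idI[symmetric])
  then have "is_struct L N'"
    using N dm by (fastforce simp: is_struct_def N'_def tuples_def)
  moreover have "isomorphism L N N' c"
    using inj dm by (auto simp: isomorphism_def embedding_def N'_def tuples_def simp del: map_map)
  ultimately show thesis by (rule that)
qed

lemma equivalent_model_on_formulas:
  fixes N :: "('f, 'r, 'a) struct"
  assumes N: "is_struct L N"
  obtains N' :: "('f, 'r, ('f, 'r) fm) struct" where "is_struct L N'"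
    and "\<And>\<sigma>. \<sigma> \<in> fmls L 0 \<Longrightarrow> holds N' \<sigma> [] = holds N \<sigma> []"
proof -
  have ne: "carr N \<noteq> {}" using N by (simp add: is_struct_def)
  let ?c = "\<lambda>x. skolem_code (inv (skolem_val N) x)"
  have "inj_on ?c (carr (skolem_hull N))"
    by (auto intro!: inj_onI simp: skolem_hull_def dest!: injD[OF inj_skolem_code])
      (metis f_inv_into_f rangeI)
  then obtain N' where N': "is_struct L N'" "isomorphism L (skolem_hull N) N' ?c"
    using isomorphic_copy[OF is_struct_skolem_hull[OF N]] by blast
  have "holds N' \<sigma> [] = holds N \<sigma> []" if \<sigma>: "\<sigma> \<in> fmls L 0" for \<sigma>
  proof -
    define v :: "nat \<Rightarrow> 'a" where "v = (\<lambda>_. skolem_val N undefined)"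
    have "sat N' (\<lambda>i. ?c (v i)) \<sigma> = sat (skolem_hull N) v \<sigma>"
      using N'(2) \<sigma> unfolding isomorphism_def
      by (intro sat_embedding[OF _ is_struct_skolem_hull[OF N]]) (auto simp: fmls_def)
    also have "\<dots> = sat N v \<sigma>"
      by (intro sat_skolem_hull[OF ne]) (auto simp: v_def)
    finally show ?thesis
      unfolding holds_def using \<sigma>
      by (metis (no_types, lifting) fmls_def lessThan_0 mem_Collect_eq sat_cong subset_empty empty_iff)
  qed
  with N'(1) show thesis by (rule that)
qed

text \<open>
  In each model, the true sentences are exactly the consequences of \<open>T\<close>. Consequence refers
  only to models on the type of formulas, hence the detour through such a model.
\<close>

lemma complete_theory_elem_equiv:
  fixes N :: "('f, 'r, 'a) struct" and M :: "('f, 'r, 'b) struct"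
  assumes T: "complete_theory L T" and "models L N T" "models L M T"
  shows "elem_map L N M {}"
proof -
  have dec: "holds K \<sigma> [] \<longleftrightarrow> entails L T \<sigma>" if K: "models L K T" and \<sigma>: "\<sigma> \<in> fmls L 0"
    for K :: "('f, 'r, 'e) struct" and \<sigma>
  proof -
    obtain K' :: "('f, 'r, ('f, 'r) fm) struct" where K': "is_struct L K'"
      "\<And>\<sigma>. \<sigma> \<in> fmls L 0 \<Longrightarrow> holds K' \<sigma> [] = holds K \<sigma> []"
      using K equivalent_model_on_formulas unfolding models_def by blast
    have "models L K' T"
      using K K' T unfolding models_def complete_theory_def by blast
    then have *: "entails L T \<tau> \<Longrightarrow> holds K' \<tau> []" for \<tau>
      by (simp add: entails_def)
    have "entails L T \<sigma> \<or> entails L T (Neg \<sigma>)"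
      using T \<sigma> by (auto simp: complete_theory_def)
    then show ?thesis
      using K'(2)[OF \<sigma>] *[of \<sigma>] *[of "Neg \<sigma>"] by (auto simp: holds_def)
  qed
  have "elem_map L N M (set (zip [] []))"
    using dec[OF assms(2)] dec[OF assms(3)] by (intro elem_map_zipI) auto
  then show ?thesis by simp
qed


section \<open>Transfer of indiscernibles into a saturated model\<close>

lemma elem_map_converse: "elem_map L N M G \<Longrightarrow> elem_map L M N (G\<inverse>)"
  unfolding elem_map_def
proof (intro allI impI)
  fix \<phi> and v :: "nat \<Rightarrow> _"
  assume em: "\<forall>\<phi> v. wf_fm L \<phi> \<and> v ` fvars \<phi> \<subseteq> G \<longrightarrow>
      sat N (\<lambda>i. fst (v i)) \<phi> = sat M (\<lambda>i. snd (v i)) \<phi>"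
    and v: "wf_fm L \<phi> \<and> v ` fvars \<phi> \<subseteq> G\<inverse>"
  have "(\<lambda>i. prod.swap (v i)) ` fvars \<phi> \<subseteq> G"
    using v by fastforce
  then show "sat M (\<lambda>i. fst (v i)) \<phi> = sat N (\<lambda>i. snd (v i)) \<phi>"
    using em[rule_format, of \<phi> "\<lambda>i. prod.swap (v i)"] v by simp
qed

text \<open>
  The one-point extension property of saturated structures: the type of \<open>d\<close> over the domain
  of \<open>G\<close>, transported along \<open>G\<close>, is finitely satisfiable by elementarity, and any of its
  realizations is a possible image of \<open>d\<close>.
\<close>

lemma elem_map_extend:
  assumes em: "elem_map L N M G" and sat: "saturated L M \<kappa>" and small: "|snd ` G| <o \<kappa>"
    and G: "snd ` G \<subseteq> carr M" and d: "d \<in> carr N"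
  obtains e where "e \<in> carr M" "elem_map L N M (insert (d, e) G)"
proof -
  define p where "p = {(\<phi>, map snd gs) | \<phi> gs. set gs \<subseteq> G \<and> \<phi> \<in> fmls L (1 + length gs) \<and>
    holds N \<phi> (d # map fst gs)}"
  have p: "p \<subseteq> pfmls L (snd ` G) 1"
  proof
    fix y assume "y \<in> p"
    then obtain \<phi> gs where y: "y = (\<phi>, map snd gs)" "set gs \<subseteq> G" "\<phi> \<in> fmls L (1 + length gs)"
      by (auto simp: p_def)
    then have "set (map snd gs) \<subseteq> snd ` G" by (simp add: image_mono)
    with y show "y \<in> pfmls L (snd ` G) 1" by (simp add: pfmls_def)
  qed
  have "consistent M 1 p"
    unfolding consistent_def
  proof (intro allI impI)
    fix q assume q: "q \<subseteq> p" "finite q"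
    have "\<forall>y\<in>q. \<exists>gs. snd y = map snd gs \<and> set gs \<subseteq> G \<and> fst y \<in> fmls L (1 + length gs) \<and>
      holds N (fst y) (d # map fst gs)"
    proof
      fix y assume "y \<in> q"
      then obtain \<phi> gs where "y = (\<phi>, map snd gs)" "set gs \<subseteq> G" "\<phi> \<in> fmls L (1 + length gs)"
        "holds N \<phi> (d # map fst gs)"
        using q(1) by (auto simp: p_def)
      then show "\<exists>gs. snd y = map snd gs \<and> set gs \<subseteq> G \<and> fst y \<in> fmls L (1 + length gs) \<and>
          holds N (fst y) (d # map fst gs)"
        by (intro exI[of _ gs]) simp
    qed
    then obtain h where h: "\<And>y. y \<in> q \<Longrightarrow> snd y = map snd (h y) \<and> set (h y) \<subseteq> G \<and>
      fst y \<in> fmls L (1 + length (h y)) \<and> holds N (fst y) (d # map fst (h y))"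
      by metis
    let ?q = "(\<lambda>y. (fst y, map fst (h y), snd y)) ` q"
    have "\<exists>xs\<in>tuples M 1. \<forall>(\<phi>, as, bs)\<in>?q. holds M \<phi> (xs @ bs)"
    proof (rule elem_map_realizes[OF em])
      show "finite ?q" using q(2) by simp
      show "length bs = length as \<and> \<phi> \<in> fmls L (1 + length as) \<and> set (zip as bs) \<subseteq> G"
        if "(\<phi>, as, bs) \<in> ?q" for \<phi> as bs
      proof -
        have y: "(\<phi>, bs) \<in> q" and as: "as = map fst (h (\<phi>, bs))" using that by auto
        define gs where "gs = h (\<phi>, bs)"
        have "bs = map snd gs" "set gs \<subseteq> G" "\<phi> \<in> fmls L (1 + length gs)" "as = map fst gs"
          using h[OF y] as unfolding gs_def by simp_all
        then show ?thesis by (simp add: zip_map_fst_snd)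
      qed
      show "\<exists>xs\<in>tuples N 1. \<forall>(\<phi>, as, bs)\<in>?q. holds N \<phi> (xs @ as)"
      proof (intro bexI[of _ "[d]"] ballI)
        fix t assume "t \<in> ?q"
        then obtain y where "y \<in> q" "t = (fst y, map fst (h y), snd y)" by blast
        then show "case t of (\<phi>, as, bs) \<Rightarrow> holds N \<phi> ([d] @ as)"
          using h[of y] by simp
      qed (use d in \<open>simp add: tuples_def\<close>)
    qed
    then obtain xs where "xs \<in> tuples M 1" "\<forall>(\<phi>, as, bs)\<in>?q. holds M \<phi> (xs @ bs)" by blast
    then show "\<exists>bs\<in>tuples M 1. realizes M bs q"
      by (intro bexI[of _ xs]) (simp_all add: realizes_def case_prod_unfold)
  qed
  then obtain bs where bs: "bs \<in> tuples M 1" "realizes M bs p"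
    using sat[unfolded saturated_def, rule_format, of "snd ` G" p 1] small G p by blast
  then obtain e where e: "bs = [e]" "e \<in> carr M"
    by (auto simp: tuples_def length_Suc_conv)
  have transfer: "holds N \<phi> (d # map fst gs) = holds M \<phi> (e # map snd gs)"
    if gs: "set gs \<subseteq> G" and \<phi>: "\<phi> \<in> fmls L (1 + length gs)" for \<phi> gs
  proof -
    have "holds M \<psi> (e # map snd gs)"
      if "\<psi> \<in> fmls L (1 + length gs)" "holds N \<psi> (d # map fst gs)" for \<psi>
    proof -
      have "(\<psi>, map snd gs) \<in> p" using that gs unfolding p_def by blast
      then show ?thesis using bs(2) e(1) by (auto simp: realizes_def)
    qed
    \<comment> \<open>The converse implication comes from the negation.\<close>
    from this[of \<phi>] this[of "Neg \<phi>"] \<phi> show ?thesis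
      by (auto simp: holds_def fmls_def)
  qed
  have "elem_map L N M (insert (d, e) G)"
    unfolding elem_map_def
  proof (intro allI impI)
    fix \<phi> and v :: "nat \<Rightarrow> _"
    assume v: "wf_fm L \<phi> \<and> v ` fvars \<phi> \<subseteq> insert (d, e) G"
    obtain gs where gs: "set gs = v ` fvars \<phi> - {(d, e)}"
      using finite_list[of "v ` fvars \<phi> - {(d, e)}"] finite_fvars by blast
    \<comment> \<open>Only finitely many pairs of \<open>G\<close> occur, and together with \<open>(d, e)\<close> they form an
      elementary map.\<close>
    have "elem_map L N M (set (zip (d # map fst gs) (e # map snd gs)))"
      using transfer[of gs] gs v by (intro elem_map_zipI) auto
    moreover have "v ` fvars \<phi> \<subseteq> set (zip (d # map fst gs) (e # map snd gs))"
      using gs by (auto simp: zip_map_fst_snd)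
    ultimately show "sat N (\<lambda>i. fst (v i)) \<phi> = sat M (\<lambda>i. snd (v i)) \<phi>"
      using v unfolding elem_map_def by blast
  qed
  with e(2) show thesis by (rule that)
qed

text \<open>
  A maximal elementary extension of the empty map is total on \<open>D\<close> by the one-point extension
  property. Elementary maps are injective and single-valued, which keeps the set of parameters
  small throughout.
\<close>

lemma elem_map_total:
  assumes em: "elem_map L N M {}" and sat: "saturated L M \<kappa>" and small: "|D| <o \<kappa>"
    and D: "D \<subseteq> carr N"
  obtains g where "g ` D \<subseteq> carr M" "elem_map L N M ((\<lambda>d. (d, g d)) ` D)"
proof -
  define \<A> where "\<A> = {G. G \<subseteq> D \<times> carr M \<and> elem_map L N M G}"
  have "\<exists>G\<in>\<A>. \<forall>H\<in>\<A>. G \<subseteq> H \<longrightarrow> H = G"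
  proof (rule subset_Zorn_nonempty)
    have "{} \<in> \<A>" using em by (simp add: \<A>_def)
    then show "\<A> \<noteq> {}" by blast
  next
    fix \<C> assume C: "\<C> \<noteq> {}" "subset.chain \<A> \<C>"
    have "elem_map L N M (\<Union>\<C>)"
      unfolding elem_map_def
    proof (intro allI impI)
      fix \<phi> and v :: "nat \<Rightarrow> _" assume v: "wf_fm L \<phi> \<and> v ` fvars \<phi> \<subseteq> \<Union>\<C>"
      then have "finite (v ` fvars \<phi>)" "v ` fvars \<phi> \<subseteq> \<Union>\<C>" by (simp_all add: finite_fvars)
      then obtain G where "G \<in> \<C>" "v ` fvars \<phi> \<subseteq> G"
        using C by (rule finite_subset_Union_chain)
      moreover from \<open>G \<in> \<C>\<close> C(2) have "elem_map L N M G"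
        by (auto simp: \<A>_def subset_chain_def)
      ultimately show "sat N (\<lambda>i. fst (v i)) \<phi> = sat M (\<lambda>i. snd (v i)) \<phi>"
        using v unfolding elem_map_def by blast
    qed
    moreover have "\<Union>\<C> \<subseteq> D \<times> carr M"
      using C(2) unfolding \<A>_def subset_chain_def by blast
    ultimately show "\<Union>\<C> \<in> \<A>"
      by (simp add: \<A>_def)
  qed
  then obtain G where "G \<in> \<A>" and max: "\<And>H. H \<in> \<A> \<Longrightarrow> G \<subseteq> H \<Longrightarrow> H = G"
    by blast
  then have G: "G \<subseteq> D \<times> carr M" "elem_map L N M G"
    by (simp_all add: \<A>_def)
  have "inj_on fst G"
  proof (rule inj_onI)
    fix x y assume xy: "x \<in> G" "y \<in> G" "fst x = fst y"
    define v where "v = (\<lambda>i::nat. if i = 0 then x else y)"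
    have "sat N (\<lambda>i. fst (v i)) (Eq (Var 0) (Var 1)) = sat M (\<lambda>i. snd (v i)) (Eq (Var 0) (Var 1))"
      using G(2)[unfolded elem_map_def, rule_format, of "Eq (Var 0) (Var 1)" v] xy(1,2)
      by (simp add: v_def)
    then show "x = y" using xy(3) by (simp add: v_def prod_eq_iff)
  qed
  then have "|G| \<le>o |D|"
    using G(1) by (intro card_of_ordLeqI[of fst]) auto
  then have small': "|snd ` G| <o \<kappa>"
    by (rule ordLeq_ordLess_trans[OF ordLeq_transitive[OF card_of_image] small])
  have "\<exists>e. (d, e) \<in> G" if "d \<in> D" for d
  proof -
    obtain e where "e \<in> carr M" "elem_map L N M (insert (d, e) G)"
      by (rule elem_map_extend[OF G(2) sat small', of d]) (use G(1) D \<open>d \<in> D\<close> in auto)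
    then have "insert (d, e) G = G"
      using G(1) \<open>d \<in> D\<close> by (intro max) (simp_all add: \<A>_def subset_insertI)
    then show ?thesis by blast
  qed
  then obtain g where g: "\<And>d. d \<in> D \<Longrightarrow> (d, g d) \<in> G" by metis
  show thesis
  proof (rule that)
    show "g ` D \<subseteq> carr M" using g G(1) by blast
    show "elem_map L N M ((\<lambda>d. (d, g d)) ` D)"
      using g by (intro elem_map_mono[OF G(2)]) blast
  qed
qed

lemma small_parameters:
  assumes I: "|I| <o \<kappa>" and \<kappa>: "natLeq <o \<kappa>"
  shows "|\<Union>\<eta>\<in>I. set (a \<eta>)| <o \<kappa>"
proof -
  have nat: "|UNIV :: nat set| =o natLeq" by (rule card_of_nat)
  have "|I \<times> (UNIV :: nat set)| <o \<kappa>"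
  proof (cases "|I| \<le>o natLeq")
    case True
    have "|I \<times> (UNIV :: nat set)| \<le>o natLeq"
      using True nat natLeq_Card_order ordIso_imp_ordLeq[OF nat]
      by (intro card_of_Times_ordLeq_infinite_Field) (auto simp: Field_natLeq)
    then show ?thesis using \<kappa> by (rule ordLeq_ordLess_trans)
  next
    case False
    then have le: "natLeq \<le>o |I|"
      using natLeq_Well_order card_of_Well_order ordLeq_total by blast
    then have "|UNIV :: nat set| \<le>o |I|" using nat ordIso_ordLeq_trans by blast
    moreover from this have "\<not> finite I" using card_of_ordLeq_infinite infinite_UNIV_nat by blast
    ultimately have "|I \<times> (UNIV :: nat set)| \<le>o |I|"
      by (intro card_of_Times_ordLeq_infinite_Field card_of_Card_order)
        (simp_all add: Field_card_of card_of_mono1)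
    then show ?thesis using I by (rule ordLeq_ordLess_trans)
  qed
  moreover have "(\<Union>\<eta>\<in>I. set (a \<eta>)) \<subseteq> (\<lambda>(\<eta>, j). a \<eta> ! j) ` (I \<times> UNIV)"
    by (force simp: in_set_conv_nth)
  then have "|\<Union>\<eta>\<in>I. set (a \<eta>)| \<le>o |I \<times> (UNIV :: nat set)|"
    by (rule ordLeq_transitive[OF card_of_mono1 card_of_image])
  ultimately show ?thesis by (metis ordLeq_ordLess_trans)
qed

lemma set_zip_concat:
  assumes "length xs = length ys"
    and "\<And>x y. (x, y) \<in> set (zip xs ys) \<Longrightarrow> length (a x) = length (b y)"
  shows "set (zip (concat (map a xs)) (concat (map b ys)))
    = (\<Union>(x, y)\<in>set (zip xs ys). set (zip (a x) (b y)))"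
  using assms by (induction xs ys rule: list_induct2) auto

lemma length_concat_const:
  "(\<And>x. x \<in> set xs \<Longrightarrow> length (a x) = m) \<Longrightarrow> length (concat (map a xs)) = length xs * m"
  by (induction xs) auto

lemma indisc_iff_elem_map:
  "indisc Ls I L M {} m a \<longleftrightarrow> (\<forall>\<eta>\<in>carr I. a \<eta> \<in> tuples M m) \<and>
    (\<forall>\<eta>s \<nu>s. qf_sim Ls I \<eta>s \<nu>s \<longrightarrow>
      elem_map L M M (set (zip (concat (map a \<eta>s)) (concat (map a \<nu>s)))))"
proof -
  have "tp L M {} (concat (map a \<eta>s)) = tp L M {} (concat (map a \<nu>s)) \<longleftrightarrow>
      elem_map L M M (set (zip (concat (map a \<eta>s)) (concat (map a \<nu>s))))"
    if a: "\<forall>\<eta>\<in>carr I. a \<eta> \<in> tuples M m" and sim: "qf_sim Ls I \<eta>s \<nu>s" for \<eta>s \<nu>s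
  proof -
    have "length (concat (map a xs)) = length xs * m" if "set xs \<subseteq> carr I" for xs
      using a that by (intro length_concat_const) (auto simp: tuples_def)
    then show ?thesis using sim by (intro tp_empty_eq_iff) (simp add: qf_sim_def)
  qed
  then show ?thesis unfolding indisc_def by blast
qed

text \<open>
  A finite subset of the family of formulas comes from a finite set of indices.
\<close>

lemma consistent_family_iff:
  "consistent M n ((\<lambda>\<eta>. (\<phi>, a \<eta>)) ` X) \<longleftrightarrow>
    (\<forall>X0\<subseteq>X. finite X0 \<longrightarrow> (\<exists>bs\<in>tuples M n. \<forall>\<eta>\<in>X0. holds M \<phi> (bs @ a \<eta>)))"
  (is "_ = ?R")
proof
  assume c: "consistent M n ((\<lambda>\<eta>. (\<phi>, a \<eta>)) ` X)"
  show ?R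
  proof (intro allI impI)
    fix X0 assume "X0 \<subseteq> X" "finite X0"
    then have "\<exists>bs\<in>tuples M n. realizes M bs ((\<lambda>\<eta>. (\<phi>, a \<eta>)) ` X0)"
      using c unfolding consistent_def by (meson finite_imageI image_mono)
    then show "\<exists>bs\<in>tuples M n. \<forall>\<eta>\<in>X0. holds M \<phi> (bs @ a \<eta>)"
      by (auto simp: realizes_def)
  qed
next
  assume R: ?R
  show "consistent M n ((\<lambda>\<eta>. (\<phi>, a \<eta>)) ` X)"
    unfolding consistent_def
  proof (intro allI impI)
    fix q assume "q \<subseteq> (\<lambda>\<eta>. (\<phi>, a \<eta>)) ` X" "finite q"
    then obtain X0 where "X0 \<subseteq> X" "finite X0" "q = (\<lambda>\<eta>. (\<phi>, a \<eta>)) ` X0"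
      by (meson finite_subset_image)
    then show "\<exists>bs\<in>tuples M n. realizes M bs q"
      using R by (fastforce simp: realizes_def)
  qed
qed

lemma elem_map_joint_realization:
  assumes em: "elem_map L N M G" and "finite X" and "\<phi> \<in> fmls L (n + m)"
    and X: "\<And>x. x \<in> X \<Longrightarrow> length (a x) = m \<and> length (b x) = m \<and> set (zip (a x) (b x)) \<subseteq> G"
    and ex: "\<exists>xs\<in>tuples N n. \<forall>x\<in>X. holds N \<phi> (xs @ a x)"
  shows "\<exists>xs\<in>tuples M n. \<forall>x\<in>X. holds M \<phi> (xs @ b x)"
proof -
  let ?q = "(\<lambda>x. (\<phi>, a x, b x)) ` X"
  have "\<exists>xs\<in>tuples M n. \<forall>(\<phi>, as, bs)\<in>?q. holds M \<phi> (xs @ bs)"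
    using assms(2,3) X ex by (intro elem_map_realizes[OF em]) auto
  then show ?thesis by simp
qed

text \<open>
  The image of \<open>a\<close> under an elementary map defined on all its entries. Consistency and
  inconsistency along an index set both survive, since finite joint realizability is first-order.
\<close>

lemma witness_transfer:
  fixes N :: "('f, 'r, 'n) struct" and M :: "('f, 'r, 'm) struct"
  assumes equiv: "elem_map L N M {}" and sat: "saturated L M \<kappa>"
    and small: "|carr I| <o \<kappa>" "natLeq <o \<kappa>" and "X \<subseteq> carr I" "\<forall>Y\<in>Ys. Y \<subseteq> carr I"
    and ind: "indisc Ls I L N {} m a" and wit: "nvar_witness L N X Ys \<phi> n m a"
  obtains a' where "indisc Ls I L M {} m a'" "nvar_witness L M X Ys \<phi> n m a'"
proof -
  define D where "D = (\<Union>\<eta>\<in>carr I. set (a \<eta>))"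
  have a: "\<And>\<eta>. \<eta> \<in> carr I \<Longrightarrow> a \<eta> \<in> tuples N m"
    using ind by (simp add: indisc_def)
  have "D \<subseteq> carr N" using a by (auto simp: D_def tuples_def)
  moreover have "|D| <o \<kappa>" unfolding D_def by (rule small_parameters[OF small])
  ultimately obtain g where g: "g ` D \<subseteq> carr M" "elem_map L N M ((\<lambda>d. (d, g d)) ` D)"
    using elem_map_total[OF equiv sat] by blast
  let ?a = "\<lambda>\<eta>. map g (a \<eta>)"
  let ?G = "(\<lambda>d. (d, g d)) ` D"
  have a': "?a \<eta> \<in> tuples M m" if "\<eta> \<in> carr I" for \<eta>
    using a[OF that] g(1) that by (auto simp: tuples_def D_def)
  have zip_G: "set (zip xs (map g xs)) \<subseteq> ?G" if "set xs \<subseteq> D" for xs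
    using that by (auto simp: zip_map2 zip_same_conv_map)
  have holds_g: "holds N \<psi> xs = holds M \<psi> (map g xs)"
    if "\<psi> \<in> fmls L (length xs)" "set xs \<subseteq> D" for \<psi> xs
    using that by (intro elem_map_holds[OF g(2)] zip_G) auto
  have "indisc Ls I L M {} m ?a"
    unfolding indisc_iff_elem_map
  proof (intro conjI ballI allI impI)
    fix \<eta>s \<nu>s assume sim: "qf_sim Ls I \<eta>s \<nu>s"
    let ?xs = "concat (map a \<eta>s)" and ?ys = "concat (map a \<nu>s)"
    have em: "elem_map L N N (set (zip ?xs ?ys))"
      using ind sim by (simp add: indisc_iff_elem_map)
    have D: "set ?xs \<subseteq> D" "set ?ys \<subseteq> D"
      using sim by (auto simp: D_def qf_sim_def)
    have len: "length ?ys = length ?xs"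
      using sim a by (auto simp: qf_sim_def tuples_def length_concat_const subset_iff)
    have "elem_map L M M (set (zip (map g ?xs) (map g ?ys)))"
    proof (rule elem_map_zipI)
      fix \<psi> assume "\<psi> \<in> fmls L (length (map g ?xs))"
      then show "holds M \<psi> (map g ?xs) = holds M \<psi> (map g ?ys)"
        using elem_map_holds[OF em _ len] holds_g[of \<psi> ?xs] holds_g[of \<psi> ?ys] D len by auto
    qed (use len in simp)
    then show "elem_map L M M (set (zip (concat (map ?a \<eta>s)) (concat (map ?a \<nu>s))))"
      by (simp add: map_concat comp_def)
  qed (rule a')
  moreover have "consistent N n ((\<lambda>\<eta>. (\<phi>, a \<eta>)) ` Z) \<longleftrightarrow> consistent M n ((\<lambda>\<eta>. (\<phi>, ?a \<eta>)) ` Z)"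
    if Z: "Z \<subseteq> carr I" for Z
  proof -
    have \<phi>: "\<phi> \<in> fmls L (n + m)" using wit by (simp add: nvar_witness_def)
    have props: "length (a \<eta>) = m" "set (zip (a \<eta>) (?a \<eta>)) \<subseteq> ?G"
      "set (zip (?a \<eta>) (a \<eta>)) \<subseteq> ?G\<inverse>" if "\<eta> \<in> carr I" for \<eta>
    proof -
      show "length (a \<eta>) = m" using a[OF that] by (simp add: tuples_def)
      show *: "set (zip (a \<eta>) (?a \<eta>)) \<subseteq> ?G" using that by (intro zip_G) (auto simp: D_def)
      then show "set (zip (?a \<eta>) (a \<eta>)) \<subseteq> ?G\<inverse>"
        by (subst zip_commute) auto
    qed
    have "(\<exists>bs\<in>tuples N n. \<forall>\<eta>\<in>Z0. holds N \<phi> (bs @ a \<eta>)) \<longleftrightarrow>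
        (\<exists>bs\<in>tuples M n. \<forall>\<eta>\<in>Z0. holds M \<phi> (bs @ ?a \<eta>))" if "Z0 \<subseteq> Z" "finite Z0" for Z0
    proof
      have Z0: "\<eta> \<in> carr I" if "\<eta> \<in> Z0" for \<eta>
        using that \<open>Z0 \<subseteq> Z\<close> Z by blast
      show "\<exists>bs\<in>tuples M n. \<forall>\<eta>\<in>Z0. holds M \<phi> (bs @ ?a \<eta>)"
        if "\<exists>bs\<in>tuples N n. \<forall>\<eta>\<in>Z0. holds N \<phi> (bs @ a \<eta>)"
        by (rule elem_map_joint_realization[OF g(2) \<open>finite Z0\<close> \<phi> _ that])
          (use props Z0 in \<open>simp only: length_map\<close>)
      show "\<exists>bs\<in>tuples N n. \<forall>\<eta>\<in>Z0. holds N \<phi> (bs @ a \<eta>)"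
        if "\<exists>bs\<in>tuples M n. \<forall>\<eta>\<in>Z0. holds M \<phi> (bs @ ?a \<eta>)"
        by (rule elem_map_joint_realization[OF elem_map_converse[OF g(2)] \<open>finite Z0\<close> \<phi> _ that])
          (use props Z0 in \<open>simp only: length_map\<close>)
    qed
    then show ?thesis unfolding consistent_family_iff by blast
  qed
  then have "nvar_witness L M X Ys \<phi> n m ?a"
    using wit assms(5,6) by (simp add: nvar_witness_def)
  ultimately show thesis by (rule that)
qed


section \<open>New witnesses along cofinal embeddings\<close>

lemma qf_sim_embedding:
  assumes I: "is_struct Ls I" and f: "embedding Ls I I f" and \<eta>s: "set \<eta>s \<subseteq> carr I"
  shows "qf_sim Ls I \<eta>s (map f \<eta>s)"
proof -
  have "holds I \<phi> \<eta>s = holds I \<phi> (map f \<eta>s)"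
    if "\<phi> \<in> fmls Ls (length \<eta>s)" "qfree \<phi>" for \<phi>
  proof -
    have v: "(!) \<eta>s ` fvars \<phi> \<subseteq> carr I"
      using that(1) \<eta>s by (force simp: fmls_def)
    have "holds I \<phi> (map f \<eta>s) = sat I (\<lambda>i. f (\<eta>s ! i)) \<phi>"
      unfolding holds_def using that(1) by (intro sat_cong) (auto simp: fmls_def)
    also have "\<dots> = holds I \<phi> \<eta>s"
      unfolding holds_def using that v by (intro sat_embedding[OF f I]) (auto simp: fmls_def)
    finally show ?thesis by simp
  qed
  moreover have "f ` carr I \<subseteq> carr I" using f by (simp add: embedding_def)
  ultimately show ?thesis using \<eta>s by (auto simp: qf_sim_def)
qed

lemma qf_sim_sym: "qf_sim Ls I xs ys \<Longrightarrow> qf_sim Ls I ys xs"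
  by (auto simp: qf_sim_def)

lemma qf_sim_trans: "qf_sim Ls I xs ys \<Longrightarrow> qf_sim Ls I ys zs \<Longrightarrow> qf_sim Ls I xs zs"
  by (auto simp: qf_sim_def)

lemma holds_append:
  assumes "\<phi> \<in> fmls L (length xs)"
  shows "holds M \<phi> (xs @ ys) = holds M \<phi> xs"
  unfolding holds_def using assms by (intro sat_cong) (auto simp: fmls_def nth_append)

locale cofinal_index =
  fixes Ls :: "('g, 's) lang" and Is :: "('g, 's, 'i) struct"
    and X :: "'i set" and Ys :: "'i set set"
    and L :: "('f, 'r) lang" and M :: "('f, 'r, 'm) struct"
  assumes Is: "is_struct Ls Is" and cofinal: "cofinal_in Ls Is X"
    and X: "X \<subseteq> carr Is" and Ys: "\<And>Y. Y \<in> Ys \<Longrightarrow> Y \<subseteq> carr Is"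
    and M: "is_struct L M"
begin

definition witness :: "('f, 'r) fm \<Rightarrow> nat \<Rightarrow> nat \<Rightarrow> ('i \<Rightarrow> 'm list) \<Rightarrow> bool" where
  "witness \<phi> n m a \<longleftrightarrow> indisc Ls Is L M {} m a \<and> nvar_witness L M X Ys \<phi> n m a"

definition params :: "('i \<Rightarrow> 'm list) \<Rightarrow> 'm set" where
  "params a = (\<Union>\<eta>\<in>carr Is. set (a \<eta>))"

text \<open>
  However the other coordinates are chosen, \<open>\<phi>(x, a\<^sub>\<eta>)\<close> has at most \<open>k\<close> solutions in
  \<open>x\<^sub>i\<close>. The bound is required only at the parameters \<open>a\<^sub>\<eta>\<close>.
\<close>

definition bounded_in ::
  "nat \<Rightarrow> nat \<Rightarrow> ('f, 'r) fm \<Rightarrow> nat \<Rightarrow> ('i \<Rightarrow> 'm list) \<Rightarrow> bool" where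
  "bounded_in i k \<phi> n a \<longleftrightarrow> (\<forall>xs\<in>tuples M n. \<forall>\<eta>\<in>carr Is.
     finite {e \<in> carr M. holds M \<phi> (xs[i := e] @ a \<eta>)} \<and>
     card {e \<in> carr M. holds M \<phi> (xs[i := e] @ a \<eta>)} \<le> k)"

lemma indisc_joint_realization:
  assumes ind: "indisc Ls Is L M {} m a" and \<phi>: "\<phi> \<in> fmls L (n + m)"
    and sim: "qf_sim Ls Is xs ys"
    and ex: "\<exists>bs\<in>tuples M n. \<forall>x\<in>set xs. holds M \<phi> (bs @ a x)"
  shows "\<exists>bs\<in>tuples M n. \<forall>y\<in>set ys. holds M \<phi> (bs @ a y)"
proof -
  have len: "length xs = length ys" and carr: "set xs \<subseteq> carr Is" "set ys \<subseteq> carr Is"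
    using sim by (auto simp: qf_sim_def)
  have a: "length (a x) = m" if "x \<in> carr Is" for x
    using ind that by (simp add: indisc_def tuples_def)
  have lens: "length (a x) = length (a y)" if "(x, y) \<in> set (zip xs ys)" for x y
    using that carr a by (metis set_zip_leftD set_zip_rightD subsetD)
  let ?G = "set (zip (concat (map a xs)) (concat (map a ys)))"
  have G: "elem_map L M M ?G"
    using ind sim by (simp add: indisc_iff_elem_map)
  have "\<exists>bs\<in>tuples M n. \<forall>t\<in>set (zip xs ys). holds M \<phi> (bs @ a (snd t))"
  proof (rule elem_map_joint_realization[OF G _ \<phi>])
    show "length (a (fst t)) = m \<and> length (a (snd t)) = m \<and> set (zip (a (fst t)) (a (snd t))) \<subseteq> ?G"
      if "t \<in> set (zip xs ys)" for t
    proof (intro conjI)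
      have "fst t \<in> set xs" "snd t \<in> set ys"
        using that by (metis prod.collapse set_zip_leftD, metis prod.collapse set_zip_rightD)
      then show "length (a (fst t)) = m" "length (a (snd t)) = m" using a carr by blast+
      show "set (zip (a (fst t)) (a (snd t))) \<subseteq> ?G"
        using that by (subst set_zip_concat[OF len lens]) (auto simp: case_prod_unfold)
    qed
    show "\<exists>bs\<in>tuples M n. \<forall>t\<in>set (zip xs ys). holds M \<phi> (bs @ a (fst t))"
      using ex by (metis prod.collapse set_zip_leftD)
  qed simp
  moreover have "snd ` set (zip xs ys) = set ys"
    using len by (metis list.set_map map_snd_zip)
  ultimately show ?thesis by (metis imageE)
qed

text \<open>
  The entries of \<open>ps\<close> come from \<open>a\<close> at a finite set \<open>Z\<close> of indices. The embedding \<open>f\<close> obtained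
  from cofinality for \<open>Z\<close> makes similar tuples of its image similar over \<open>Z\<close>, so
  \<open>\<eta> \<mapsto> a (f \<eta>) @ ps\<close> is indiscernible. The tuple \<open>b\<close> shows that \<open>\<theta>\<close> is consistent along the indices
  sent into \<open>X\<close>, and these have the same finite patterns as \<open>X\<close>. Inconsistency along \<open>Y\<close> is
  inherited from \<open>\<phi>\<close>, because \<open>a \<circ> f\<close> and \<open>a\<close> have the same types along similar tuples.
\<close>

lemma relocate_witness:
  assumes wit: "witness \<phi> n m a" and ps: "set ps \<subseteq> params a"
    and \<theta>: "\<theta> \<in> fmls L (n' + (m + length ps))"
    and b: "b \<in> tuples M n'" "\<And>\<eta>. \<eta> \<in> X \<Longrightarrow> holds M \<theta> (b @ a \<eta> @ ps)"
    and imp: "\<And>c. c \<in> tuples M n' \<Longrightarrow>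
      \<exists>c'\<in>tuples M n. \<forall>d\<in>tuples M m. holds M \<theta> (c @ d @ ps) \<longrightarrow> holds M \<phi> (c' @ d)"
  obtains f where "f ` carr Is \<subseteq> carr Is" and "witness \<theta> n' (m + length ps) (\<lambda>\<eta>. a (f \<eta>) @ ps)"
proof -
  have ind: "indisc Ls Is L M {} m a" and nwit: "nvar_witness L M X Ys \<phi> n m a"
    using wit by (auto simp: witness_def)
  have a: "a \<eta> \<in> tuples M m" if "\<eta> \<in> carr Is" for \<eta>
    using ind that by (simp add: indisc_def)
  have "\<forall>p\<in>set ps. \<exists>\<eta>\<in>carr Is. p \<in> set (a \<eta>)" using ps by (auto simp: params_def)
  then obtain h where h: "\<And>p. p \<in> set ps \<Longrightarrow> h p \<in> carr Is \<and> p \<in> set (a (h p))"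
    by metis
  \<comment> \<open>Cofinality is applied to the finite set of indices whose tuples contain \<open>ps\<close>.\<close>
  obtain zs where zs: "set zs = h ` set ps" "distinct zs"
    using finite_distinct_list[of "h ` set ps"] by auto
  have Z: "h ` set ps \<subseteq> carr Is" using h by blast
  then obtain f where f: "embedding Ls Is Is f"
    and f_sim: "\<And>\<eta>s \<nu>s. set \<eta>s \<subseteq> f ` carr Is \<Longrightarrow> set \<nu>s \<subseteq> f ` carr Is \<Longrightarrow>
      qf_sim Ls Is \<eta>s \<nu>s \<Longrightarrow> qf_sim Ls Is (\<eta>s @ zs) (\<nu>s @ zs)"
    and fX: "fin_sim Ls Is (f ` carr Is \<inter> X) X"
    using cofinal[unfolded cofinal_in_def, rule_format, of "h ` set ps"] zs by auto
  have fI: "f ` carr Is \<subseteq> carr Is" using f by (simp add: embedding_def)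
  note sim_f = qf_sim_embedding[OF Is f]
  let ?a = "\<lambda>\<eta>. a (f \<eta>) @ ps"
  have a': "?a \<eta> \<in> tuples M (m + length ps)" if "\<eta> \<in> carr Is" for \<eta>
    using that a fI h by (fastforce simp: tuples_def)
  have ind': "indisc Ls Is L M {} (m + length ps) ?a"
    unfolding indisc_iff_elem_map
  proof (intro conjI ballI allI impI)
    fix \<eta>s \<nu>s assume sim: "qf_sim Ls Is \<eta>s \<nu>s"
    then have len: "length \<eta>s = length \<nu>s" and carr: "set \<eta>s \<subseteq> carr Is" "set \<nu>s \<subseteq> carr Is"
      by (auto simp: qf_sim_def)
    let ?xs = "map f \<eta>s @ zs" and ?ys = "map f \<nu>s @ zs"
    have "qf_sim Ls Is (map f \<eta>s) (map f \<nu>s)"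
      by (meson qf_sim_sym qf_sim_trans sim sim_f carr)
    then have sim': "qf_sim Ls Is ?xs ?ys"
      using carr by (intro f_sim) auto
    let ?G = "set (zip (concat (map a ?xs)) (concat (map a ?ys)))"
    have "elem_map L M M ?G" using ind sim' by (simp only: indisc_iff_elem_map)
    moreover have "set (zip (concat (map ?a \<eta>s)) (concat (map ?a \<nu>s))) \<subseteq> ?G"
    proof -
      have pair: "x \<in> carr Is \<and> y \<in> carr Is" if "(x, y) \<in> set (zip ?xs ?ys)" for x y
        using that sim' by (metis qf_sim_def set_zip_leftD set_zip_rightD subsetD)
      have G: "?G = (\<Union>(x, y)\<in>set (zip ?xs ?ys). set (zip (a x) (a y)))"
        using len pair a by (intro set_zip_concat) (auto simp: tuples_def)
      have zip': "zip ?xs ?ys = map (\<lambda>(x, y). (f x, f y)) (zip \<eta>s \<nu>s) @ map (\<lambda>z. (z, z)) zs"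
        using len by (simp add: zip_map_map zip_same_conv_map)
      have "set (zip (a (f x)) (a (f y))) \<subseteq> ?G" if "(x, y) \<in> set (zip \<eta>s \<nu>s)" for x y
        unfolding G zip' using that by fastforce
      moreover have "set (zip ps ps) \<subseteq> ?G"
      proof
        fix t assume "t \<in> set (zip ps ps)"
        then obtain p where p: "t = (p, p)" "p \<in> set ps" by (auto simp: zip_same_conv_map)
        then have "h p \<in> set zs" "t \<in> set (zip (a (h p)) (a (h p)))"
          using h zs(1) by (auto simp: zip_same_conv_map)
        then show "t \<in> ?G" unfolding G zip' by fastforce
      qed
      moreover have "length (?a x) = length (?a y)" "length (a (f x)) = length (a (f y))"
        if "(x, y) \<in> set (zip \<eta>s \<nu>s)" for x y
      proof -
        have "x \<in> carr Is" "y \<in> carr Is"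
          using that carr by (auto dest: set_zip_leftD set_zip_rightD)
        then have "a (f x) \<in> tuples M m" "a (f y) \<in> tuples M m" using fI by (auto intro: a)
        then show "length (?a x) = length (?a y)" "length (a (f x)) = length (a (f y))"
          by (simp_all add: tuples_def)
      qed
      ultimately have sub: "set (zip (?a x) (?a y)) \<subseteq> ?G" and lens: "length (?a x) = length (?a y)"
        if "(x, y) \<in> set (zip \<eta>s \<nu>s)" for x y
        using that by simp_all
      have "set (zip (concat (map ?a \<eta>s)) (concat (map ?a \<nu>s)))
          = (\<Union>(x, y)\<in>set (zip \<eta>s \<nu>s). set (zip (?a x) (?a y)))"
        by (rule set_zip_concat[OF len lens])
      then show ?thesis using sub by blast
    qed
    ultimately show "elem_map L M M (set (zip (concat (map ?a \<eta>s)) (concat (map ?a \<nu>s))))"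
      by (rule elem_map_mono)
  qed (rule a')
  have "consistent M n' ((\<lambda>\<eta>. (\<theta>, ?a \<eta>)) ` X)"
    unfolding consistent_family_iff
  proof (intro allI impI)
    fix X0 assume "X0 \<subseteq> X" "finite X0"
    then obtain A0 where "A0 \<subseteq> f ` carr Is \<inter> X" "set_sim Ls Is X0 A0"
      using fX unfolding fin_sim_def by blast
    then obtain xs ys where xs: "set xs = X0" "set ys \<subseteq> f ` carr Is" "set ys \<subseteq> X"
      "qf_sim Ls Is xs ys"
      unfolding set_sim_def by auto
    \<comment> \<open>The finite pattern \<open>X0\<close> reappears in the part of \<open>X\<close> covered by \<open>f\<close>.\<close>
    define us where "us = map (inv_into (carr Is) f) ys"
    have us: "ys = map f us" "set us \<subseteq> carr Is"
    proof -
      have "map f us = map (\<lambda>y. y) ys"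
        unfolding us_def map_map using xs(2) by (intro map_cong) (auto intro: f_inv_into_f)
      then show "ys = map f us" by simp
      show "set us \<subseteq> carr Is"
        unfolding us_def using xs(2) by (auto intro: inv_into_into)
    qed
    have "qf_sim Ls Is us xs"
      using sim_f[OF us(2)] xs(4) us(1) qf_sim_sym qf_sim_trans by metis
    moreover have "\<exists>bs\<in>tuples M n'. \<forall>x\<in>set us. holds M \<theta> (bs @ ?a x)"
      using b xs(3) us(1) by (intro bexI[of _ b]) auto
    ultimately show "\<exists>bs\<in>tuples M n'. \<forall>\<eta>\<in>X0. holds M \<theta> (bs @ ?a \<eta>)"
      using indisc_joint_realization[OF ind' \<theta>] xs(1) by blast
  qed
  moreover have "\<not> consistent M n' ((\<lambda>\<eta>. (\<theta>, ?a \<eta>)) ` Y)" if Y: "Y \<in> Ys" for Y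
  proof
    assume c: "consistent M n' ((\<lambda>\<eta>. (\<theta>, ?a \<eta>)) ` Y)"
    have "consistent M n ((\<lambda>\<eta>. (\<phi>, a \<eta>)) ` Y)"
      unfolding consistent_family_iff
    proof (intro allI impI)
      fix Y0 assume Y0: "Y0 \<subseteq> Y" "finite Y0"
      obtain ys where ys: "set ys = Y0" using finite_list[OF Y0(2)] by blast
      have carr: "set ys \<subseteq> carr Is" using ys Y0(1) Ys[OF Y] by blast
      obtain c where c: "c \<in> tuples M n'" "\<forall>\<eta>\<in>Y0. holds M \<theta> (c @ ?a \<eta>)"
        using c Y0 unfolding consistent_family_iff by blast
      obtain c' where c': "c' \<in> tuples M n"
        "\<forall>d\<in>tuples M m. holds M \<theta> (c @ d @ ps) \<longrightarrow> holds M \<phi> (c' @ d)"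
        using imp[OF c(1)] by blast
      have "holds M \<phi> (c' @ a (f \<eta>))" if "\<eta> \<in> Y0" for \<eta>
      proof -
        have "a (f \<eta>) \<in> tuples M m" using that ys carr fI by (intro a) blast
        then show ?thesis using c(2) c'(2) that by auto
      qed
      then have "\<exists>bs\<in>tuples M n. \<forall>x\<in>set (map f ys). holds M \<phi> (bs @ a x)"
        using c'(1) ys by (intro bexI[of _ c']) auto
      then show "\<exists>bs\<in>tuples M n. \<forall>\<eta>\<in>Y0. holds M \<phi> (bs @ a \<eta>)"
        using indisc_joint_realization[OF ind _ qf_sim_sym[OF sim_f[OF carr]]] nwit ys
        by (auto simp: nvar_witness_def)
    qed
    then show False using nwit Y by (simp add: nvar_witness_def)
  qed
  ultimately have "witness \<theta> n' (m + length ps) ?a"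
    using ind' \<theta> by (simp add: witness_def nvar_witness_def)
  with fI show thesis by (rule that)
qed

text \<open>
  A bound on the solutions of \<open>\<gamma>\<close> at the single tuple \<open>b\<close> becomes uniform when the statement
  that there are at most \<open>k\<close> solutions is conjoined to \<open>\<gamma>\<close>; relocation then turns the
  conjunction with \<open>\<phi>\<close> into a witness.
\<close>

lemma bounded_witness:
  assumes wit: "witness \<phi> n m a" and b: "b \<in> tuples M n" "\<forall>\<eta>\<in>X. holds M \<phi> (b @ a \<eta>)"
    and i: "i < n" and ps: "set ps \<subseteq> params a" and \<gamma>: "\<gamma> \<in> fmls L (n + length ps)"
    and \<gamma>b: "holds M \<gamma> (b @ ps)"
    and fin: "finite {e \<in> carr M. holds M \<gamma> (b[i := e] @ ps)}"
      "card {e \<in> carr M. holds M \<gamma> (b[i := e] @ ps)} \<le> k"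
  shows "\<exists>\<phi>' m' a'. witness \<phi>' n m' a' \<and> bounded_in i k \<phi>' n a'"
proof -
  have ne: "carr M \<noteq> {}" using M by (simp add: is_struct_def)
  let ?S = "\<lambda>xs. {e \<in> carr M. holds M \<gamma> (xs[i := e] @ ps)}"
  define \<psi> where "\<psi> = Conj \<gamma> (atmost k i \<gamma>)"
  have \<psi>: "\<psi> \<in> fmls L (n + length ps)"
    using \<gamma> fvars_atmost[of k i \<gamma>] by (auto simp: \<psi>_def fmls_def wf_atmost)
  have holds_\<psi>: "holds M \<psi> (xs @ ps) \<longleftrightarrow> holds M \<gamma> (xs @ ps) \<and> finite (?S xs) \<and> card (?S xs) \<le> k"
    if "length xs = n" for xs
  proof -
    have "((!) (xs @ ps))(i := c) = (!) (xs[i := c] @ ps)" for c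
      using i that by (auto simp: nth_append nth_list_update fun_eq_iff)
    then show ?thesis
      unfolding \<psi>_def holds_def sat.simps sat_atmost[OF ne] by simp
  qed
  define \<theta> where "\<theta> = Conj \<phi> (ren (\<lambda>j. if j < n then j else j + m) \<psi>)"
  have \<phi>: "\<phi> \<in> fmls L (n + m)" using wit by (simp add: witness_def nvar_witness_def)
  have "ren (\<lambda>j. if j < n then j else j + m) \<psi> \<in> fmls L (n + (m + length ps))"
    using \<psi> by (rule fmls_ren) auto
  then have \<theta>: "\<theta> \<in> fmls L (n + (m + length ps))"
    using \<phi> by (auto simp: \<theta>_def fmls_def)
  have holds_\<theta>: "holds M \<theta> (xs @ d @ ps) \<longleftrightarrow> holds M \<phi> (xs @ d) \<and> holds M \<psi> (xs @ ps)"
    if "length xs = n" "length d = m" for xs d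
  proof -
    have "holds M \<phi> ((xs @ d) @ ps) = holds M \<phi> (xs @ d)"
      using \<phi> that by (intro holds_append) simp
    moreover have "holds M (ren (\<lambda>j. if j < n then j else j + m) \<psi>) (xs @ d @ ps) = holds M \<psi> (xs @ ps)"
      using \<psi> that by (intro holds_ren[of _ L]) (auto simp: nth_append)
    ultimately show ?thesis by (simp add: \<theta>_def holds_def)
  qed
  have a: "a \<eta> \<in> tuples M m" if "\<eta> \<in> carr Is" for \<eta>
    using wit that by (simp add: witness_def indisc_def)
  obtain f where f: "f ` carr Is \<subseteq> carr Is" "witness \<theta> n (m + length ps) (\<lambda>\<eta>. a (f \<eta>) @ ps)"
  proof (rule relocate_witness[OF wit ps \<theta> b(1)])
    show "holds M \<theta> (b @ a \<eta> @ ps)" if "\<eta> \<in> X" for \<eta>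
    proof -
      have "length b = n" "length (a \<eta>) = m" using b(1) a[of \<eta>] X that by (auto simp: tuples_def)
      then show ?thesis using holds_\<theta> holds_\<psi> b(2)[rule_format, OF that] \<gamma>b fin by simp
    qed
    show "\<exists>c'\<in>tuples M n. \<forall>d\<in>tuples M m. holds M \<theta> (c @ d @ ps) \<longrightarrow> holds M \<phi> (c' @ d)"
      if "c \<in> tuples M n" for c
      using that holds_\<theta> by (intro bexI[of _ c]) (auto simp: tuples_def)
  qed
  have "bounded_in i k \<theta> n (\<lambda>\<eta>. a (f \<eta>) @ ps)"
    unfolding bounded_in_def
  proof (intro ballI)
    fix xs \<eta> assume xs: "xs \<in> tuples M n" and \<eta>: "\<eta> \<in> carr Is"
    let ?T = "{e \<in> carr M. holds M \<theta> (xs[i := e] @ a (f \<eta>) @ ps)}"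
    have len: "length xs = n" "length (a (f \<eta>)) = m"
      using xs a[of "f \<eta>"] \<eta> f(1) by (auto simp: tuples_def)
    have T: "e \<in> ?S xs \<and> finite (?S xs) \<and> card (?S xs) \<le> k" if "e \<in> ?T" for e
    proof -
      have "holds M \<psi> (xs[i := e] @ ps)" using that holds_\<theta>[of "xs[i := e]"] len by simp
      then show ?thesis using that holds_\<psi>[of "xs[i := e]"] len by simp
    qed
    show "finite ?T \<and> card ?T \<le> k"
    proof (cases "?T = {}")
      case True
      then show ?thesis by (simp only: finite.emptyI card.empty le0 simp_thms)
    next
      case False
      then have S: "finite (?S xs)" "card (?S xs) \<le> k" using T by blast+
      have "?T \<subseteq> ?S xs" using T by blast
      then show ?thesis using S by (meson card_mono finite_subset le_trans)
    qed
  qed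
  with f(2) show ?thesis by blast
qed

text \<open>
  The heart of the argument. The case \<open>S\<^sub>\<zeta> \<not>\<subseteq> S\<^sub>\<eta>\<close> is excluded by minimality of \<open>k\<close>, through
  \<open>bounded_witness\<close> with the parameters of both \<open>\<zeta>\<close> and \<open>\<eta>\<close>; afterwards the formula
  \<open>\<emptyset> \<noteq> S\<^sub>\<zeta> \<subseteq> S\<^sub>\<eta>\<close> replaces \<open>\<phi>\<close>, and \<open>x\<^sub>i\<close> is no longer free.
\<close>

lemma eliminate_bounded_variable:
  assumes wit: "witness \<phi> n m a" and bd: "bounded_in i k \<phi> n a" and i: "i < n"
    and min: "\<And>\<phi>' m' a' k'. \<lbrakk>witness \<phi>' n m' a'; bounded_in i k' \<phi>' n a'\<rbrakk> \<Longrightarrow> k \<le> k'"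
    and b: "b \<in> tuples M n" "\<forall>\<eta>\<in>X. holds M \<phi> (b @ a \<eta>)"
    and "X \<noteq> {}"
  shows "\<exists>\<phi>' m' a'. witness \<phi>' (n - 1) m' a'"
proof -
  obtain \<zeta> where \<zeta>: "\<zeta> \<in> X" using \<open>X \<noteq> {}\<close> by blast
  have \<phi>: "\<phi> \<in> fmls L (n + m)" using wit by (simp add: witness_def nvar_witness_def)
  have a: "a \<eta> \<in> tuples M m" if "\<eta> \<in> carr Is" for \<eta>
    using wit that by (simp add: witness_def indisc_def)
  let ?S = "\<lambda>\<eta>. {e \<in> carr M. holds M \<phi> (b[i := e] @ a \<eta>)}"
  have sub: "?S \<zeta> \<subseteq> ?S \<eta>" if \<eta>: "\<eta> \<in> X" for \<eta>
  proof (rule ccontr)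
    assume "\<not> ?S \<zeta> \<subseteq> ?S \<eta>"
    then have less: "?S \<zeta> \<inter> ?S \<eta> \<subset> ?S \<zeta>" by blast
    have S: "finite (?S \<zeta>)" "card (?S \<zeta>) \<le> k" using bd b(1) \<zeta> X unfolding bounded_in_def by auto
    have len: "length (a \<zeta>) = m" "length (a \<eta>) = m" "length b = n"
      using a \<zeta> \<eta> X b(1) by (auto simp: tuples_def)
    define \<gamma> where "\<gamma> = Conj \<phi> (ren (\<lambda>j. if j < n then j else j + m) \<phi>)"
    have "ren (\<lambda>j. if j < n then j else j + m) \<phi> \<in> fmls L (n + (m + m))"
      using \<phi> by (rule fmls_ren) auto
    then have \<gamma>: "\<gamma> \<in> fmls L (n + length (a \<zeta> @ a \<eta>))"
      using \<phi> len by (auto simp: \<gamma>_def fmls_def)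
    have holds_\<gamma>: "holds M \<gamma> (xs @ a \<zeta> @ a \<eta>) \<longleftrightarrow> holds M \<phi> (xs @ a \<zeta>) \<and> holds M \<phi> (xs @ a \<eta>)"
      if "length xs = n" for xs
    proof -
      have "holds M \<phi> ((xs @ a \<zeta>) @ a \<eta>) = holds M \<phi> (xs @ a \<zeta>)"
        using \<phi> that len by (intro holds_append) simp
      moreover have "holds M (ren (\<lambda>j. if j < n then j else j + m) \<phi>) (xs @ a \<zeta> @ a \<eta>)
          = holds M \<phi> (xs @ a \<eta>)"
        using \<phi> that len by (intro holds_ren[of _ L]) (auto simp: nth_append)
      ultimately show ?thesis by (simp add: \<gamma>_def holds_def)
    qed
    have eq: "{e \<in> carr M. holds M \<gamma> (b[i := e] @ a \<zeta> @ a \<eta>)} = ?S \<zeta> \<inter> ?S \<eta>"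
      using holds_\<gamma> len by auto
    have "card (?S \<zeta> \<inter> ?S \<eta>) < card (?S \<zeta>)" using less S(1) by (rule psubset_card_mono[rotated])
    then have card: "card (?S \<zeta> \<inter> ?S \<eta>) \<le> k - 1" "0 < k" using S(2) by auto
    have ps: "set (a \<zeta> @ a \<eta>) \<subseteq> params a" using \<zeta> \<eta> X by (auto simp: params_def)
    have \<gamma>b: "holds M \<gamma> (b @ a \<zeta> @ a \<eta>)" using holds_\<gamma> b(2) \<zeta> \<eta> len by simp
    have fin: "finite (?S \<zeta> \<inter> ?S \<eta>)" using S(1) by blast
    have "\<exists>\<phi>' m' a'. witness \<phi>' n m' a' \<and> bounded_in i (k - 1) \<phi>' n a'"
    proof (rule bounded_witness[OF wit b i ps \<gamma>])
      show "holds M \<gamma> (b @ (a \<zeta> @ a \<eta>))" by (rule \<gamma>b)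
      show "finite {e \<in> carr M. holds M \<gamma> (b[i := e] @ (a \<zeta> @ a \<eta>))}" unfolding eq by (rule fin)
      show "card {e \<in> carr M. holds M \<gamma> (b[i := e] @ (a \<zeta> @ a \<eta>))} \<le> k - 1"
        unfolding eq by (rule card(1))
    qed
    then obtain \<phi>' m' a' where "witness \<phi>' n m' a'" "bounded_in i (k - 1) \<phi>' n a'" by blast
    then have "k \<le> k - 1" by (rule min)
    then show False using card(2) by simp
  qed
  \<comment> \<open>The free variables are \<open>x\<close> without \<open>x\<^sub>i\<close>, then \<open>y\<close>, then the parameters \<open>a\<^sub>\<zeta>\<close>; the variable
    \<open>?N\<close> behind them plays the role of \<open>x\<^sub>i\<close>. The renamings \<open>\<rho>y\<close> and \<open>\<rho>z\<close> substitute \<open>y\<close> and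
    \<open>a\<^sub>\<zeta>\<close> into \<open>\<phi>\<close>.\<close>
  let ?N = "n - 1 + (m + m)"
  define \<rho>y where "\<rho>y = (\<lambda>j. if j < i then j else if j = i then ?N else j - 1)"
  define \<rho>z where "\<rho>z = (\<lambda>j. if j < i then j else if j = i then ?N
    else if j < n then j - 1 else j - 1 + m)"
  define \<chi> where "\<chi> = Conj (Ex ?N (ren \<rho>z \<phi>))
    (Neg (Ex ?N (Conj (ren \<rho>z \<phi>) (Neg (ren \<rho>y \<phi>)))))"
  have len: "length (a \<zeta>) = m" using a \<zeta> X by (auto simp: tuples_def)
  have "\<rho>y j \<le> ?N" "\<rho>z j \<le> ?N" if "j < n + m" for j
    using that i by (auto simp: \<rho>y_def \<rho>z_def)
  then have "fvars (ren \<rho>z \<phi>) \<subseteq> {..?N}" "fvars (ren \<rho>y \<phi>) \<subseteq> {..?N}"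
    using \<phi> by (auto simp: fvars_ren fmls_def subset_iff)
  then have "fvars \<chi> \<subseteq> {..?N} - {?N}"
    unfolding \<chi>_def fvars.simps by blast
  then have \<chi>: "\<chi> \<in> fmls L (n - 1 + (m + length (a \<zeta>)))"
    using \<phi> len by (force simp: \<chi>_def fmls_def wf_ren)
  have holds_\<chi>: "holds M \<chi> (c @ d @ a \<zeta>) \<longleftrightarrow>
      (\<exists>e\<in>carr M. holds M \<phi> ((take i c @ e # drop i c) @ a \<zeta>)) \<and>
      (\<forall>e\<in>carr M. holds M \<phi> ((take i c @ e # drop i c) @ a \<zeta>) \<longrightarrow>
        holds M \<phi> ((take i c @ e # drop i c) @ d))"
    if c: "length c = n - 1" "length d = m" for c d
  proof -
    have ins: "(take i c @ e # drop i c) ! j = (if j < i then c ! j else if j = i then e else c ! (j - 1))"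
      if "j < n" for j e
      using that c i by (simp add: nth_append min_absorb2 nth_Cons')
    have len_ins: "length (take i c @ e # drop i c) = n" for e using c i by simp
    have y: "sat M (((!) (c @ d @ a \<zeta>))(?N := e)) (ren \<rho>y \<phi>)
        = holds M \<phi> ((take i c @ e # drop i c) @ d)" for e
      unfolding sat_ren holds_def
    proof (rule sat_cong)
      fix j assume "j \<in> fvars \<phi>"
      then have "j < n + m" using \<phi> by (auto simp: fmls_def)
      then show "(((!) (c @ d @ a \<zeta>))(?N := e)) (\<rho>y j) = ((take i c @ e # drop i c) @ d) ! j"
        using c i unfolding nth_append[of "take i c @ e # drop i c"] len_ins
        by (cases "j < n") (auto simp: ins \<rho>y_def nth_append)
    qed
    have z: "sat M (((!) (c @ d @ a \<zeta>))(?N := e)) (ren \<rho>z \<phi>)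
        = holds M \<phi> ((take i c @ e # drop i c) @ a \<zeta>)" for e
      unfolding sat_ren holds_def
    proof (rule sat_cong)
      fix j assume "j \<in> fvars \<phi>"
      then have "j < n + m" using \<phi> by (auto simp: fmls_def)
      then show "(((!) (c @ d @ a \<zeta>))(?N := e)) (\<rho>z j) = ((take i c @ e # drop i c) @ a \<zeta>) ! j"
        using c i unfolding nth_append[of "take i c @ e # drop i c"] len_ins
        by (cases "j < n") (auto simp: ins \<rho>z_def nth_append)
    qed
    show ?thesis
      unfolding holds_def[of M \<chi>] unfolding \<chi>_def sat.simps y z by blast
  qed
  let ?b = "take i b @ drop (Suc i) b"
  have b_len: "length b = n" using b(1) by (simp add: tuples_def)
  have ins: "take i ?b @ e # drop i ?b = b[i := e]" for e
    using i b_len by (simp add: upd_conv_take_nth_drop)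
  have bt: "?b \<in> tuples M (n - 1)"
    using b(1) i by (auto simp: tuples_def dest!: in_set_takeD in_set_dropD)
  have bi: "b ! i \<in> carr M" using b(1) i by (auto simp: tuples_def)
  have on_X: "holds M \<chi> (?b @ a \<eta> @ a \<zeta>)" if \<eta>: "\<eta> \<in> X" for \<eta>
  proof -
    have lens: "length ?b = n - 1" "length (a \<eta>) = m" using bt a \<eta> X by (auto simp: tuples_def)
    have "holds M \<phi> (b[i := b ! i] @ a \<zeta>)" using b(2)[rule_format, OF \<zeta>] by simp
    then have "\<exists>e\<in>carr M. holds M \<phi> (b[i := e] @ a \<zeta>)" using bi by blast
    moreover have "\<forall>e\<in>carr M. holds M \<phi> (b[i := e] @ a \<zeta>) \<longrightarrow> holds M \<phi> (b[i := e] @ a \<eta>)"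
      using sub[OF \<eta>] by blast
    ultimately show ?thesis unfolding holds_\<chi>[OF lens] ins by (rule conjI)
  qed
  have imp: "\<exists>c'\<in>tuples M n. \<forall>d\<in>tuples M m. holds M \<chi> (c @ d @ a \<zeta>) \<longrightarrow> holds M \<phi> (c' @ d)"
    if c: "c \<in> tuples M (n - 1)" for c
  proof (cases "\<exists>e\<in>carr M. holds M \<phi> ((take i c @ e # drop i c) @ a \<zeta>)")
    case True
    then obtain e where e: "e \<in> carr M" "holds M \<phi> ((take i c @ e # drop i c) @ a \<zeta>)" by blast
    show ?thesis
    proof (intro bexI ballI impI)
      show "take i c @ e # drop i c \<in> tuples M n"
        using c e(1) i by (auto simp: tuples_def dest!: in_set_takeD in_set_dropD)
      fix d assume "d \<in> tuples M m" "holds M \<chi> (c @ d @ a \<zeta>)"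
      then show "holds M \<phi> ((take i c @ e # drop i c) @ d)"
        using holds_\<chi>[of c d] c e by (auto simp: tuples_def)
    qed
  next
    case False
    then show ?thesis
      using holds_\<chi>[of c] c b(1) by (intro bexI[of _ b]) (auto simp: tuples_def)
  qed
  have "set (a \<zeta>) \<subseteq> params a" using \<zeta> X by (auto simp: params_def)
  then obtain f where "witness \<chi> (n - 1) (m + length (a \<zeta>)) (\<lambda>\<eta>. a (f \<eta>) @ a \<zeta>)"
    using relocate_witness[OF wit _ \<chi> bt on_X imp] by meson
  then show ?thesis by blast
qed

text \<open>
  The formula \<open>\<psi>\<close> for algebraicity has parameters both from the family and among the other
  coordinates of \<open>b\<close>; the latter are replaced by the corresponding variables.
\<close>

lemma bounded_witness_of_acl:
  assumes wit: "witness \<phi> n m a" and b: "b \<in> tuples M n" "\<forall>\<eta>\<in>X. holds M \<phi> (b @ a \<eta>)"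
    and i: "i < n" and acl: "b ! i \<in> acl L M (params a \<union> {b ! j | j. j < n \<and> j \<noteq> i})"
  shows "\<exists>k \<phi>' m' a'. witness \<phi>' n m' a' \<and> bounded_in i k \<phi>' n a'"
proof -
  obtain \<psi> qs where qs: "set qs \<subseteq> params a \<union> {b ! j | j. j < n \<and> j \<noteq> i}"
    and \<psi>: "\<psi> \<in> fmls L (1 + length qs)" "holds M \<psi> (b ! i # qs)"
    and fin: "finite {c \<in> carr M. holds M \<psi> (c # qs)}"
    using acl by (auto simp: acl_def pfmls_def)
  define ps where "ps = filter (\<lambda>q. q \<in> params a) qs"
  have len: "length b = n" using b(1) by (simp add: tuples_def)
  have "\<exists>t. t < n + length ps \<and> t \<noteq> i \<and> (b @ ps) ! t = qs ! j" if j: "j < length qs" for j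
  proof (cases "qs ! j \<in> params a")
    case True
    then have "qs ! j \<in> set ps" using j by (simp add: ps_def)
    then obtain t where "t < length ps" "ps ! t = qs ! j" by (auto simp: in_set_conv_nth)
    then show ?thesis using len i by (intro exI[of _ "n + t"]) (simp add: nth_append)
  next
    case False
    then obtain t where "t < n" "t \<noteq> i" "qs ! j = b ! t" using qs j nth_mem by blast
    then show ?thesis using len by (intro exI[of _ t]) (simp add: nth_append)
  qed
  then obtain \<tau> where \<tau>: "\<And>j. j < length qs \<Longrightarrow>
      \<tau> j < n + length ps \<and> \<tau> j \<noteq> i \<and> (b @ ps) ! \<tau> j = qs ! j"
    by metis
  define \<rho> where "\<rho> = (\<lambda>j. case j of 0 \<Rightarrow> i | Suc j \<Rightarrow> \<tau> j)"
  have \<gamma>: "ren \<rho> \<psi> \<in> fmls L (n + length ps)"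
    using \<psi>(1) by (rule fmls_ren) (use i \<tau> in \<open>auto simp: \<rho>_def split: nat.splits\<close>)
  have holds_\<gamma>: "holds M (ren \<rho> \<psi>) (b[i := e] @ ps) = holds M \<psi> (e # qs)" for e
  proof (rule holds_ren[of _ L])
    show "\<psi> \<in> fmls L (length (e # qs))" using \<psi>(1) by simp
    show "(b[i := e] @ ps) ! \<rho> j = (e # qs) ! j" if "j < length (e # qs)" for j
    proof (cases j)
      case 0
      then show ?thesis using len i by (simp add: \<rho>_def nth_append)
    next
      case (Suc j')
      then have "\<tau> j' \<noteq> i" "(b @ ps) ! \<tau> j' = qs ! j'" using \<tau>[of j'] that by auto
      then show ?thesis using Suc by (auto simp: \<rho>_def nth_append len split: if_splits)
    qed
  qed
  have "holds M (ren \<rho> \<psi>) (b @ ps)" using holds_\<gamma>[of "b ! i"] \<psi>(2) by simp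
  moreover have "set ps \<subseteq> params a" by (auto simp: ps_def)
  ultimately show ?thesis
    using bounded_witness[OF wit b i _ \<gamma>] fin unfolding holds_\<gamma> by blast
qed

lemma witness_realized:
  assumes wit: "witness \<phi> n m a" and sat: "saturated L M \<kappa>"
    and small: "|carr Is| <o \<kappa>" "natLeq <o \<kappa>"
  shows "\<exists>b\<in>tuples M n. \<forall>\<eta>\<in>X. holds M \<phi> (b @ a \<eta>)"
proof -
  let ?p = "(\<lambda>\<eta>. (\<phi>, a \<eta>)) ` X"
  have a: "a \<eta> \<in> tuples M m" if "\<eta> \<in> carr Is" for \<eta>
    using wit that by (simp add: witness_def indisc_def)
  have nwit: "\<phi> \<in> fmls L (n + m)" "consistent M n ?p"
    using wit by (simp_all add: witness_def nvar_witness_def)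
  have "params a \<subseteq> carr M" using a by (auto simp: params_def tuples_def)
  moreover have "|params a| <o \<kappa>" unfolding params_def by (rule small_parameters[OF small])
  moreover have "?p \<subseteq> pfmls L (params a) n"
  proof
    fix y assume "y \<in> ?p"
    then obtain \<eta> where y: "y = (\<phi>, a \<eta>)" and \<eta>: "\<eta> \<in> carr Is" using X by blast
    have "length (a \<eta>) = m" "set (a \<eta>) \<subseteq> params a"
      using a[OF \<eta>] \<eta> by (auto simp: tuples_def params_def)
    then show "y \<in> pfmls L (params a) n" using nwit(1) y by (simp add: pfmls_def)
  qed
  ultimately obtain b where "b \<in> tuples M n" "realizes M b ?p"
    using sat[unfolded saturated_def, rule_format, of "params a" ?p n] nwit(2) by blast
  then show ?thesis by (intro bexI[of _ b]) (simp_all add: realizes_def)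
qed

text \<open>
  Algebraicity of a coordinate would lead to a witness with bounded solutions, and the least
  possible bound to a witness in fewer variables.
\<close>

lemma minimal_witness_independent:
  assumes wit: "witness \<phi> n m a" and min: "\<And>\<phi>' n' m' a'. witness \<phi>' n' m' a' \<Longrightarrow> n \<le> n'"
    and sat: "saturated L M \<kappa>" and small: "|carr Is| <o \<kappa>" "natLeq <o \<kappa>" and "X \<noteq> {}"
    and b: "b \<in> tuples M n" "\<forall>\<eta>\<in>X. holds M \<phi> (b @ a \<eta>)"
    and i: "i < n"
  shows "b ! i \<notin> acl L M (params a \<union> {b ! j | j. j < n \<and> j \<noteq> i})"
proof
  define P where "P = (\<lambda>k. \<exists>\<phi>' m' a'. witness \<phi>' n m' a' \<and> bounded_in i k \<phi>' n a')"
  assume "b ! i \<in> acl L M (params a \<union> {b ! j | j. j < n \<and> j \<noteq> i})"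
  from bounded_witness_of_acl[OF wit b i this] have "\<exists>k. P k" by (simp only: P_def)
  then have "P (LEAST k. P k)" by (rule LeastI_ex)
  then obtain \<phi>' m' a' where wit': "witness \<phi>' n m' a'"
    and bd: "bounded_in i (LEAST k. P k) \<phi>' n a'" unfolding P_def by blast
  have least: "(LEAST k. P k) \<le> k'" if "witness \<phi>'' n m'' a''" "bounded_in i k' \<phi>'' n a''"
    for \<phi>'' m'' a'' k'
  proof (rule Least_le)
    show "P k'" unfolding P_def using that by blast
  qed
  obtain b' where b': "b' \<in> tuples M n" "\<forall>\<eta>\<in>X. holds M \<phi>' (b' @ a' \<eta>)"
    using witness_realized[OF wit' sat small] by blast
  have "\<exists>\<phi>'' m'' a''. witness \<phi>'' (n - 1) m'' a''"
    by (rule eliminate_bounded_variable[OF wit' bd i _ b' \<open>X \<noteq> {}\<close>]) (erule (1) least)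
  then obtain \<phi>'' m'' a'' where "witness \<phi>'' (n - 1) m'' a''" by blast
  then have "n \<le> n - 1" by (rule min)
  then show False using i by simp
qed

end

section \<open>Algebraically independent realizations\<close>

lemma mem_acl:
  assumes "b \<in> B" "b \<in> carr M"
  shows "b \<in> acl L M B"
proof -
  have "(Eq (Var 0) (Var 1), [b]) \<in> pfmls L B 1"
    using assms(1) by (simp add: pfmls_def fmls_def)
  moreover have "holds M (Eq (Var 0) (Var 1)) [c, b] \<longleftrightarrow> c = b" for c
    by (simp add: holds_def)
  ultimately show ?thesis
    using assms(2) unfolding acl_def by (intro CollectI conjI bexI[of _ "(Eq (Var 0) (Var 1), [b])"]) auto
qed

text \<open>
  Excluding \<open>bs ! i\<close> by position rather than by value makes the hypothesis cover repetitions: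
  an entry that occurs twice is algebraic over the other occurrence.
\<close>

lemma acl_dim_eq_length:
  assumes bs: "bs \<in> tuples M n"
    and ind: "\<And>i. i < n \<Longrightarrow> bs ! i \<notin> acl L M (A \<union> {bs ! j | j. j < n \<and> j \<noteq> i})"
  shows "acl_dim L M bs A = n"
proof -
  have len: "length bs = n" and carr: "set bs \<subseteq> carr M" using bs by (auto simp: tuples_def)
  have "bs ! i \<noteq> bs ! j" if "i < n" "j < n" "j \<noteq> i" for i j
  proof
    assume "bs ! i = bs ! j"
    then have "bs ! i \<in> A \<union> {bs ! j | j. j < n \<and> j \<noteq> i}" using that by blast
    moreover have "bs ! i \<in> carr M" using that(1) len carr by auto
    ultimately have "bs ! i \<in> acl L M (A \<union> {bs ! j | j. j < n \<and> j \<noteq> i})" by (rule mem_acl)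
    then show False using ind[OF that(1)] by (rule notE[rotated])
  qed
  then have dist: "distinct bs" using len by (auto simp: distinct_conv_nth)
  have "{bs ! j | j. j < n \<and> j \<noteq> i} = set bs - {bs ! i}" if "i < n" for i
    using that len dist by (auto simp: set_conv_nth nth_eq_iff_index_eq)
  then have indep: "alg_indep L M A (set bs)"
    using ind len by (auto simp: alg_indep_def in_set_conv_nth)
  have card: "card (set bs) = n" using dist len by (simp add: distinct_card)
  let ?C = "{card B | B. B \<subseteq> set bs \<and> alg_indep L M A B}"
  have "c \<le> n" if "c \<in> ?C" for c
    using that card card_mono[of "set bs"] by auto
  moreover from this have "finite ?C" by (meson finite_nat_set_iff_bounded_le)
  moreover have "n \<in> ?C" using indep card by blast
  ultimately show ?thesis unfolding acl_dim_def by (intro Max_eqI) auto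
qed

theorem theorem4p3:
  fixes Ls :: "('g, 's) lang" and Is :: "('g, 's, 'i) struct"
    and X :: "'i set" and Ys :: "'i set set"
    and L :: "('f, 'r) lang" and T :: "('f, 'r) fm set"
    and M :: "('f, 'r, 'm) struct" and \<kappa> :: "'k rel"
  assumes "n_variable_quadruple TYPE('f) TYPE('r) TYPE('m) TYPE('k) TYPE('c) TYPE('d) Ls Is X Ys"
    and "complete_theory L T"
    and "models L M T"
    and "suff_saturated L M (carr Is) \<kappa>"
    and "(L, T) \<notin> D_class TYPE('n) Ls Is X Ys"
  shows "\<exists>\<phi> n m a.
    indisc Ls Is L M {} m a \<and>
    nvar_witness L M X Ys \<phi> n m a \<and>
    (\<exists>b\<in>tuples M n. realizes M b ((\<lambda>\<eta>. (\<phi>, a \<eta>)) ` X) \<and>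
       acl_dim L M b (\<Union>\<eta>\<in>carr Is. set (a \<eta>)) = n)"
proof -
  note quad = assms(1)[unfolded n_variable_quadruple_def]
  have sat: "saturated L M \<kappa>" and small: "|carr Is| <o \<kappa>" "natLeq <o \<kappa>"
    and M: "is_struct L M"
    using assms(4) by (simp_all add: suff_saturated_def)
  have sub: "X \<subseteq> carr Is" "\<forall>Y\<in>Ys. Y \<subseteq> carr Is" and "is_struct Ls Is" "cofinal_in Ls Is X"
    and hull: "\<forall>Y\<in>Ys. Y \<subseteq> gen_sim_hull Ls Is X" and two: "\<forall>Y\<in>Ys. \<exists>\<eta>\<in>Y. \<exists>\<nu>\<in>Y. \<eta> \<noteq> \<nu>"
    by (insert quad, elim conjE, assumption)+
  then interpret cofinal_index Ls Is X Ys L M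
    using sub M by unfold_locales auto
  \<comment> \<open>Each \<open>Y\<close> has elements, and these resemble elements of \<open>X\<close>.\<close>
  have "X \<noteq> {}"
  proof -
    have "Ys \<noteq> {}" by (insert quad, elim conjE exE bexE) blast
    then obtain \<eta> where "\<eta> \<in> gen_sim_hull Ls Is X" using hull two by blast
    then show ?thesis by (auto simp: gen_sim_hull_def)
  qed
  obtain N :: "('f, 'r, 'n) struct" and \<phi>\<^sub>0 n\<^sub>0 m\<^sub>0 a\<^sub>0 where N: "models L N T"
    and N_wit: "indisc Ls Is L N {} m\<^sub>0 a\<^sub>0" "nvar_witness L N X Ys \<phi>\<^sub>0 n\<^sub>0 m\<^sub>0 a\<^sub>0"
    using assms(2,5) unfolding D_class_def by blast
  have equiv: "elem_map L N M {}" by (rule complete_theory_elem_equiv[OF assms(2) N assms(3)])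
  obtain a\<^sub>1 where "witness \<phi>\<^sub>0 n\<^sub>0 m\<^sub>0 a\<^sub>1"
    using witness_transfer[OF equiv sat small sub N_wit] unfolding witness_def by blast
  then have ex: "\<exists>n \<phi> m a. witness \<phi> n m a" by blast
  define n where "n = (LEAST n. \<exists>\<phi> m a. witness \<phi> n m a)"
  obtain \<phi> m a where wit: "witness \<phi> n m a"
    using LeastI_ex[OF ex] unfolding n_def by blast
  have min: "n \<le> n'" if "witness \<phi>' n' m' a'" for \<phi>' n' m' a'
    unfolding n_def using that by (intro Least_le) blast
  obtain b where b: "b \<in> tuples M n" "\<forall>\<eta>\<in>X. holds M \<phi> (b @ a \<eta>)"
    using witness_realized[OF wit sat small] by blast
  have "acl_dim L M b (params a) = n"
  proof (rule acl_dim_eq_length[OF b(1)])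
    show "b ! i \<notin> acl L M (params a \<union> {b ! j | j. j < n \<and> j \<noteq> i})" if "i < n" for i
      by (rule minimal_witness_independent[OF wit _ sat small \<open>X \<noteq> {}\<close> b that])
        (erule min)
  qed
  moreover have "realizes M b ((\<lambda>\<eta>. (\<phi>, a \<eta>)) ` X)" using b(2) by (auto simp: realizes_def)
  ultimately show ?thesis
    using wit b(1) unfolding witness_def params_def by blast
qed

end
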